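(* Let $H$ and $K$ be cancellative monoids, at least one of which is torsion, and let $f \colon \mathcal P_{\mathrm{fin},1}(H) \to \mathcal P_{\mathrm{fin},1}(K)$ be an isomorphism. Then $H$ and $K$ are both groups, and the pullback of $f$ is an isomorphism from $H$ to $K$.
   Context: Monoids are written multiplicatively; $1_H$ denotes the identity of a monoid $H$. Morphisms (in particular isomorphisms) are semigroup homomorphisms (isomorphisms), even between monoids. For a monoid $H$, $\mathcal P_{\mathrm{fin},1}(H)$ (the reduced finitary power monoid of $H$) is the monoid of all finite subsets of $H$ containing $1_H$, with the setwise product $XY = \{xy : x \in X,\, y \in Y\}$ and identity $\{1_H\}$. An element $a$ of $H$ is torsion if $\{a^n : n \ge 1\}$ is finite, and cancellative if left multiplication and right multiplication by $a$ are both injective on $H$; $H$ is torsion (resp. cancellative) if each of its elements is. Pullback: for arbitrary monoids $H$, $K$ and every isomorphism $f \colon \mathcal P_{\mathrm{fin},1}(H) \to \mathcal P_{\mathrm{fin},1}(K)$ there is a unique bijection $g \colon H \to K$ such that $f(\{1_H, x\}) = \{1_K, g(x)\}$ for all $x \in H$; this $g$ is called the pullback of $f$. *)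

theory Defs
  imports "HOL-Algebra.Divisibility"
begin

definition torsion_elem :: "('a, 'm) monoid_scheme \<Rightarrow> 'a \<Rightarrow> bool" where
  "torsion_elem H a \<longleftrightarrow> finite {a [^]\<^bsub>H\<^esub> n | n::nat. n \<ge> 1}"

definition torsion_monoid :: "('a, 'm) monoid_scheme \<Rightarrow> bool" where
  "torsion_monoid H \<longleftrightarrow> (\<forall>a\<in>carrier H. torsion_elem H a)"

definition power_monoid :: "('a, 'm) monoid_scheme \<Rightarrow> 'a set monoid" where
  "power_monoid H =
    \<lparr>carrier = {X. X \<subseteq> carrier H \<and> finite X \<and> \<one>\<^bsub>H\<^esub> \<in> X},
     mult = (\<lambda>X Y. X <#>\<^bsub>H\<^esub> Y),
     one = {\<one>\<^bsub>H\<^esub>}\<rparr>"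

(* The conditions determine g on carrier H only; extensionality (as part of \<rightarrow>\<^sub>E) fixes the
   junk values outside of carrier H, so that uniqueness in HOL expresses uniqueness as a map
   from carrier H to carrier K. *)
definition is_pullback ::
  "('a, 'm) monoid_scheme \<Rightarrow> ('b, 'n) monoid_scheme \<Rightarrow> ('a set \<Rightarrow> 'b set) \<Rightarrow> ('a \<Rightarrow> 'b) \<Rightarrow> bool" where
  "is_pullback H K f g \<longleftrightarrow>
     g \<in> carrier H \<rightarrow>\<^sub>E carrier K \<and> bij_betw g (carrier H) (carrier K) \<and>
     (\<forall>x\<in>carrier H. f {\<one>\<^bsub>H\<^esub>, x} = {\<one>\<^bsub>K\<^esub>, g x})"

definition pullback ::
  "('a, 'm) monoid_scheme \<Rightarrow> ('b, 'n) monoid_scheme \<Rightarrow> ('a set \<Rightarrow> 'b set) \<Rightarrow> 'a \<Rightarrow> 'b" where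
  "pullback H K f = (THE g. is_pullback H K f g)"

lemma power_monoid_is_monoid:
  assumes "monoid H"
  shows "monoid (power_monoid H)"
proof -
  interpret monoid H by fact
  have cl: "X <#>\<^bsub>H\<^esub> Y \<subseteq> carrier H" if "X \<subseteq> carrier H" "Y \<subseteq> carrier H" for X Y
    using that by (auto simp: set_mult_def)
  have fin: "finite (X <#>\<^bsub>H\<^esub> Y)" if "finite X" "finite Y" for X Y
    using that by (simp add: set_mult_def)
  have one: "\<one>\<^bsub>H\<^esub> \<in> X <#>\<^bsub>H\<^esub> Y" if "\<one>\<^bsub>H\<^esub> \<in> X" "\<one>\<^bsub>H\<^esub> \<in> Y" for X Y
    unfolding set_mult_def by (rule UN_I[OF that(1)], rule UN_I[OF that(2)]) simp
  have unit: "{\<one>\<^bsub>H\<^esub>} <#>\<^bsub>H\<^esub> X = X" "X <#>\<^bsub>H\<^esub> {\<one>\<^bsub>H\<^esub>} = X" if "X \<subseteq> carrier H" for X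
    using that by (auto simp: set_mult_def subset_iff)
  have assoc: "X <#>\<^bsub>H\<^esub> Y <#>\<^bsub>H\<^esub> Z = X <#>\<^bsub>H\<^esub> (Y <#>\<^bsub>H\<^esub> Z)"
    if "X \<subseteq> carrier H" "Y \<subseteq> carrier H" "Z \<subseteq> carrier H" for X Y Z
  proof -
    have "x \<otimes>\<^bsub>H\<^esub> y \<otimes>\<^bsub>H\<^esub> z = x \<otimes>\<^bsub>H\<^esub> (y \<otimes>\<^bsub>H\<^esub> z)" if "x \<in> X" "y \<in> Y" "z \<in> Z" for x y z
      using that \<open>X \<subseteq> carrier H\<close> \<open>Y \<subseteq> carrier H\<close> \<open>Z \<subseteq> carrier H\<close> by (intro m_assoc) auto
    then show ?thesis
      by (simp add: set_mult_def)
  qed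
  show ?thesis
    by (rule monoidI) (simp_all add: power_monoid_def cl fin one unit assoc)
qed

lemma is_pullback_unique:
  assumes "is_pullback H K f g" and "is_pullback H K f g'"
  shows "g = g'"
proof (rule PiE_ext)
  show "g \<in> carrier H \<rightarrow>\<^sub>E carrier K" and "g' \<in> carrier H \<rightarrow>\<^sub>E carrier K"
    using assms by (auto simp: is_pullback_def)
  fix x assume "x \<in> carrier H"
  then have "{\<one>\<^bsub>K\<^esub>, g x} = {\<one>\<^bsub>K\<^esub>, g' x}"
    using assms by (metis is_pullback_def)
  then show "g x = g' x"
    by (auto simp: doubleton_eq_iff)
qed

lemma pullback_eq: "is_pullback H K f g \<Longrightarrow> pullback H K f = g"
  unfolding pullback_def by (blast intro: the_equality is_pullback_unique)

end

theory Submission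
  imports Defs "HOL-Algebra.Multiplicative_Group"
begin

text \<open>
  An isomorphism \<open>f\<close> of power monoids carries every identity between products of finite sets
  containing the unit of \<open>H\<close> to an identity in \<open>K\<close>.  Once \<open>f {\<one>, x} = {\<one>, g x}\<close> is known, such
  identities between products of pairs constrain \<open>g\<close>, and the proof consists in choosing identities
  that hold in \<open>H\<close> and force \<open>g (xy) = g x g y\<close> in \<open>K\<close>.  The basic computation is that the \<open>n\<close>-th power
  of \<open>{\<one>, x}\<close> is \<open>{x\<^sup>i | i \<le> n}\<close>.

  \<^bold>\<open>Pairs and torsion.\<close>  Say \<open>H\<close> is torsion (otherwise pass to the inverse of \<open>f\<close>); being cancellative
  it is a group.  If \<open>x \<noteq> \<one>\<close> has order \<open>n\<close>, then \<open>f\<close> maps the subgroup \<open>E = {\<one>, x}\<^sup>n\<^sup>-\<^sup>1\<close> to an idempotent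
  with equally many elements, because the sets \<open>X\<close> with \<open>XE = E\<close> are the subsets of \<open>E\<close> that contain the
  unit, and \<open>f\<close> preserves their number.  The powers of \<open>Y = f {\<one>, x}\<close> grow strictly up to
  exponent \<open>n - 1\<close>, where they have \<open>n\<close> elements, so \<open>Y\<close> has at most two (\<open>image_of_pair\<close>).  If some
  \<open>y\<close> in \<open>K\<close> had infinite order, the cube of \<open>{\<one>, y}\<close> could be written as \<open>{\<one>, y} Z\<close> for two
  sets \<open>Z\<close> only; since \<open>X (X\<^sup>2 - {a}) = X\<^sup>3\<close> for all \<open>a \<noteq> \<one>\<close> in \<open>X\<close>, the preimage of \<open>{\<one>, y}\<close> would be a pair
  \<open>{\<one>, a}\<close>, whose powers become stationary while those of \<open>{\<one>, y}\<close> do not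
  (\<open>finite_period_transfer\<close>).  So \<open>K\<close> is a torsion group too.

  \<^bold>\<open>Cyclic subgroups.\<close>  The order of \<open>x\<close> is read off from the exponent at which the powers of
  \<open>{\<one>, x}\<close> become stationary, and \<open>z\<close> lies in a finite subgroup \<open>E\<close> just if \<open>{\<one>, z} E = E\<close>; so \<open>g\<close> preserves
  orders and membership in cyclic subgroups.  Intervals of exponents modulo the order then give
  \<open>g (x\<^sup>i) = (g x)\<^sup>i\<close> (\<open>g_pow\<close>).

  \<^bold>\<open>Products.\<close>  Let neither of \<open>x\<close> and \<open>y\<close> be a power of the other, let \<open>N\<close> be the order of \<open>y\<close> and let \<open>d\<close> be
  least with \<open>d > 0\<close> and \<open>x\<^sup>d\<close> a power of \<open>y\<close>.  Unless \<open>x\<^sup>d\<close> is \<open>y\<^sup>-\<^sup>2\<close>, one has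
  \<open>{\<one>, x}\<^sup>d\<^sup>-\<^sup>1 {\<one>, xy} {\<one>, y}\<^sup>N\<^sup>-\<^sup>3 = {\<one>, x}\<^sup>d {\<one>, y}\<^sup>N\<^sup>-\<^sup>2\<close>.
  In \<open>K\<close> the right-hand side omits \<open>g x (g y)\<^sup>-\<^sup>1\<close>, and since \<open>g (xy)\<close> lies in the coset \<open>g x \<langle>g y\<rangle>\<close>,
  this leaves only \<open>g (xy) = g x\<close>, which injectivity excludes, and \<open>g (xy) = g x g y\<close> (\<open>g_mult_if_step\<close>).  Exchanging left and
  right handles all such pairs except those with \<open>x\<^sup>2 y\<^sup>2 = \<one>\<close>.  For these, the argument applies to the
  pair \<open>xy\<close>, \<open>y\<^sup>-\<^sup>1\<close> with product \<open>x\<close>, unless \<open>(xy)\<^sup>2 = y\<^sup>2\<close>; then \<open>xyx = y\<close>, as for two of the standard generators of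
  the quaternion group, and \<open>{\<one>, x} {\<one>, y} = {\<one>, xy} {\<one>, x}\<close> settles the matter.
\<close>

section \<open>Powers of an element\<close>

text \<open>
  For \<open>x\<close> in a monoid, this is the \<open>n\<close>-th power of \<open>{\<one>, x}\<close> in the power monoid; the form as a set of
  powers makes the arithmetic of exponents available.
\<close>
definition powers_upto :: "('a, 'm) monoid_scheme \<Rightarrow> 'a \<Rightarrow> nat \<Rightarrow> 'a set" where
  "powers_upto G x n = (\<lambda>i::nat. x [^]\<^bsub>G\<^esub> i) ` {..n}"

text \<open>
  Natural exponents suffice for the cyclic subgroup generated by an element of finite order.
\<close>
definition powers :: "('a, 'm) monoid_scheme \<Rightarrow> 'a \<Rightarrow> 'a set" where
  "powers G x = range (\<lambda>i::nat. x [^]\<^bsub>G\<^esub> i)"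

lemma pow_mem_powers_upto: "i \<le> n \<Longrightarrow> x [^]\<^bsub>G\<^esub> (i::nat) \<in> powers_upto G x n"
  by (auto simp: powers_upto_def)

lemma set_mult_iff: "z \<in> X <#>\<^bsub>G\<^esub> Y \<longleftrightarrow> (\<exists>x\<in>X. \<exists>y\<in>Y. z = x \<otimes>\<^bsub>G\<^esub> y)"
  by (auto simp: set_mult_def)

lemma power_monoid_simps:
  "X \<in> carrier (power_monoid H) \<longleftrightarrow> X \<subseteq> carrier H \<and> finite X \<and> \<one>\<^bsub>H\<^esub> \<in> X"
  "X \<otimes>\<^bsub>power_monoid H\<^esub> Y = X <#>\<^bsub>H\<^esub> Y"
  "\<one>\<^bsub>power_monoid H\<^esub> = {\<one>\<^bsub>H\<^esub>}"
  by (auto simp: power_monoid_def)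

context monoid
begin

lemma powers_upto_0: "powers_upto G x 0 = {\<one>}"
  by (simp add: powers_upto_def)

lemma powers_upto_1: "x \<in> carrier G \<Longrightarrow> powers_upto G x 1 = {\<one>, x}"
  by (auto simp: powers_upto_def atMost_Suc)

lemma one_in_powers_upto: "\<one> \<in> powers_upto G x n"
  unfolding powers_upto_def by (rule image_eqI[of _ _ 0]) auto

lemma powers_upto_closed: "x \<in> carrier G \<Longrightarrow> powers_upto G x n \<in> carrier (power_monoid G)"
  by (simp add: power_monoid_simps one_in_powers_upto) (auto simp: powers_upto_def)

lemma pair_closed: "x \<in> carrier G \<Longrightarrow> {\<one>, x} \<in> carrier (power_monoid G)"
  by (simp add: power_monoid_simps)

lemma mult_closed_power_monoid:
  assumes "X \<in> carrier (power_monoid G)" "Y \<in> carrier (power_monoid G)"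
  shows "X <#> Y \<in> carrier (power_monoid G)"
  using monoid.m_closed[OF power_monoid_is_monoid[OF monoid_axioms] assms]
  by (simp add: power_monoid_simps)

lemma powers_upto_add:
  assumes "x \<in> carrier G"
  shows "powers_upto G x m <#> powers_upto G x n = powers_upto G x (m + n)"
proof (rule subset_antisym; rule subsetI)
  fix z assume "z \<in> powers_upto G x (m + n)"
  then obtain k where k: "k \<le> m + n" "z = x [^] k" by (auto simp: powers_upto_def)
  then have "z = x [^] min k m \<otimes> x [^] (k - min k m)"
    using assms by (simp add: nat_pow_mult)
  moreover have "k - min k m \<le> n" using k by auto
  ultimately show "z \<in> powers_upto G x m <#> powers_upto G x n"
    using pow_mem_powers_upto[of "min k m" m G x] pow_mem_powers_upto[of "k - min k m" n G x]
    unfolding set_mult_iff by auto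
qed (use assms in \<open>auto simp: set_mult_iff powers_upto_def nat_pow_mult\<close>)

lemma powers_upto_Suc:
  "x \<in> carrier G \<Longrightarrow> powers_upto G x (Suc n) = powers_upto G x n <#> {\<one>, x}"
  using powers_upto_add[of x n 1] by (simp add: powers_upto_1[simplified])

lemma pair_mult:
  assumes "a \<in> carrier G" "b \<in> carrier G"
  shows "{\<one>, a} <#> {\<one>, b} = {\<one>, a, b, a \<otimes> b}"
  using assms by (auto simp: set_mult_def)

lemma pair_powers_upto_iff:
  assumes "w \<in> carrier G" "x \<in> carrier G"
  shows "z \<in> {\<one>, w} <#> powers_upto G x n \<longleftrightarrow> (\<exists>j\<le>n. z = x [^] j \<or> z = w \<otimes> x [^] (j::nat))"
proof -
  have "\<one> \<otimes> x [^] j = x [^] j" for j :: nat using assms by simp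
  then show ?thesis unfolding set_mult_iff powers_upto_def by auto
qed

text \<open>
  The source of multiplicativity of the pullback.  In the grid of elements \<open>x\<^sup>i y\<^sup>j\<close>
  with \<open>i \<le> e + 1\<close> and \<open>j \<le> k + 1\<close>, the left-hand side covers two rectangles that leave out only the
  corners \<open>(0, k + 1)\<close> and \<open>(e + 1, 0)\<close>.  The hypothesis on \<open>x\<^sup>e\<^sup>+\<^sup>1\<close> identifies each corner with
  another position of the grid, which is covered.
\<close>
lemma staircase_identity:
  assumes x: "x \<in> carrier G" and y: "y \<in> carrier G"
    and t: "x [^] Suc e = y [^] t" "t \<le> k"
  shows "powers_upto G x e <#> ({\<one>, x \<otimes> y} <#> powers_upto G y k)
    = powers_upto G x (Suc e) <#> powers_upto G y (Suc k)" (is "?L = ?R")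
proof (rule subset_antisym; rule subsetI)
  have L: "z \<in> ?L \<longleftrightarrow> (\<exists>i\<le>e. \<exists>j\<le>k. z = x [^] i \<otimes> y [^] j \<or> z = x [^] Suc i \<otimes> y [^] Suc j)" for z
  proof -
    have 1: "x [^] i \<otimes> (\<one> \<otimes> y [^] j) = x [^] i \<otimes> y [^] j" for i j :: nat
      using y by simp
    have 2: "x [^] i \<otimes> (x \<otimes> y \<otimes> y [^] j) = x [^] Suc i \<otimes> y [^] Suc j" for i j :: nat
    proof -
      have "x [^] i \<otimes> (x \<otimes> y \<otimes> y [^] j) = x [^] i \<otimes> x \<otimes> (y \<otimes> y [^] j)"
        using x y by (simp add: m_assoc)
      then show ?thesis using y nat_pow_Suc2 by simp
    qed
    have "z \<in> ?L \<longleftrightarrow> (\<exists>i\<in>{..e}. (\<exists>j\<in>{..k}. z = x [^] i \<otimes> (\<one> \<otimes> y [^] j))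
        \<or> (\<exists>j\<in>{..k}. z = x [^] i \<otimes> (x \<otimes> y \<otimes> y [^] j)))"
      by (simp add: set_mult_def powers_upto_def)
    then show ?thesis unfolding 1 2 by blast
  qed
  have R: "z \<in> ?R \<longleftrightarrow> (\<exists>i\<le>Suc e. \<exists>j\<le>Suc k. z = x [^] i \<otimes> y [^] j)" for z
    by (simp add: set_mult_def powers_upto_def Bex_def)
  {
    fix z assume "z \<in> ?L"
    then obtain i j where "i \<le> e" "j \<le> k"
      "z = x [^] i \<otimes> y [^] j \<or> z = x [^] Suc i \<otimes> y [^] Suc j"
      unfolding L by blast
    moreover from this(1,2) have "i \<le> Suc e" "j \<le> Suc k" "Suc i \<le> Suc e" "Suc j \<le> Suc k" by simp_all
    ultimately show "z \<in> ?R" unfolding R by blast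
  next
    fix z assume "z \<in> ?R"
    then obtain i j where ij: "i \<le> Suc e" "j \<le> Suc k" "z = x [^] i \<otimes> y [^] j"
      unfolding R by blast
    consider "i \<le> e" "j \<le> k" | i' j' where "i = Suc i'" "j = Suc j'"
      | "i = 0" "j = Suc k" | "i = Suc e" "j = 0"
      using ij(1,2) by (cases i; cases j) (auto simp: le_Suc_eq)
    then show "z \<in> ?L"
    proof cases
      case 1
      then show ?thesis using ij unfolding L by blast
    next
      case 2
      then have "i' \<le> e" "j' \<le> k" using ij by auto
      then show ?thesis using ij 2 unfolding L by blast
    next
      case 3
      have "y [^] Suc k = y [^] t \<otimes> y [^] Suc (k - t)"
        using y t(2) nat_pow_mult[OF y, of t "Suc (k - t)"] by (simp del: nat_pow_Suc)
      then have "z = x [^] Suc e \<otimes> y [^] Suc (k - t)" using ij 3 t(1) y by (simp del: nat_pow_Suc)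
      moreover have "k - t \<le> k" by simp
      ultimately show ?thesis unfolding L by blast
    next
      case 4
      then have "z = x [^] (0::nat) \<otimes> y [^] t" using ij t(1) y by (simp del: nat_pow_Suc)
      then show ?thesis using t(2) unfolding L by blast
    qed
  }
qed

end

context monoid_cancel
begin

lemma pow_cancel:
  assumes "x \<in> carrier G" "x [^] i = x [^] j" "i < (j::nat)"
  shows "x [^] (j - i) = \<one>"
proof -
  have "i + (j - i) = j" using assms by simp
  then have "x [^] i \<otimes> x [^] (j - i) = x [^] i \<otimes> \<one>"
    using assms(1,2) by (metis nat_pow_mult nat_pow_closed r_one)
  then show ?thesis using assms(1) by (blast intro: l_cancel nat_pow_closed one_closed)
qed

lemma torsion_elem_period:
  assumes "x \<in> carrier G" "torsion_elem G x"
  shows "\<exists>n>0. x [^] (n::nat) = \<one>"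
proof -
  have "(\<lambda>n::nat. x [^] n) ` {1..} \<subseteq> {x [^] n | n::nat. n \<ge> 1}" by auto
  then have "finite ((\<lambda>n::nat. x [^] n) ` {1..})"
    using assms(2) unfolding torsion_elem_def by (rule finite_subset)
  then have "\<not> inj_on (\<lambda>n::nat. x [^] n) {1..}"
    using finite_imageD infinite_Ici by blast
  then obtain i j :: nat where "i \<noteq> j" "x [^] i = x [^] j" by (auto simp: inj_on_def)
  then have "x [^] (j - i) = \<one> \<and> j - i > 0 \<or> x [^] (i - j) = \<one> \<and> i - j > 0"
    using pow_cancel[OF assms(1), of i j] pow_cancel[OF assms(1), of j i] by force
  then show ?thesis by blast
qed

lemma group_if_periodic:
  assumes "\<And>x. x \<in> carrier G \<Longrightarrow> \<exists>n>0. x [^] (n::nat) = \<one>"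
  shows "group G"
proof (rule group_l_invI)
  fix x assume x: "x \<in> carrier G"
  obtain n :: nat where "n > 0" "x [^] n = \<one>" using assms[OF x] by blast
  then have "x [^] (n - 1) \<otimes> x = \<one>" by (metis Suc_pred' nat_pow_Suc)
  then show "\<exists>y\<in>carrier G. y \<otimes> x = \<one>" using x by blast
qed

end

context group
begin

lemma pow_inj:
  assumes "x \<in> carrier G" "x [^] i = x [^] j" "i < ord x" "j < ord x"
  shows "i = (j::nat)"
  using inj_onD[OF ord_inj[OF assms(1)] assms(2)] assms(3,4) by simp

lemma pow_mod_ord: "x \<in> carrier G \<Longrightarrow> x [^] (i mod ord x) = x [^] (i::nat)"
proof -
  assume x: "x \<in> carrier G"
  have "x [^] i = x [^] (ord x * (i div ord x)) \<otimes> x [^] (i mod ord x)"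
    using x by (simp add: nat_pow_mult)
  also have "x [^] (ord x * (i div ord x)) = \<one>" using x by (simp add: pow_eq_id)
  finally show ?thesis using x by simp
qed

lemma powers_upto_ord:
  assumes "x \<in> carrier G" "ord x > 0"
  shows "powers_upto G x (ord x - 1) = powers G x"
proof -
  have "powers_upto G x (ord x - 1) = {x [^] i | i. i \<in> {0..ord x - 1}}"
    by (auto simp: powers_upto_def)
  also have "\<dots> = {x [^] i | i. i \<in> (UNIV :: nat set)}"
    using ord_elems_inf_carrier[OF assms(1)] assms(2) by simp
  finally show ?thesis by (auto simp: powers_def)
qed

lemma powers_expE:
  assumes "x \<in> carrier G" "ord x > 0" "z \<in> powers G x"
  obtains i where "i < ord x" "z = x [^] (i::nat)"
proof -
  have "z \<in> powers_upto G x (ord x - 1)" using assms powers_upto_ord by blast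
  then obtain i where "i \<le> ord x - 1" "z = x [^] i" by (auto simp: powers_upto_def)
  then show ?thesis using assms that[of i] by simp
qed

lemma powers_pow: "x [^] (i::nat) \<in> powers G x" by (auto simp: powers_def)

lemma powers_self: "x \<in> carrier G \<Longrightarrow> x \<in> powers G x"
  using powers_pow[of x 1] by simp

lemma powers_subset: "x \<in> carrier G \<Longrightarrow> powers G x \<subseteq> carrier G"
  by (auto simp: powers_def)

lemma powers_mult:
  "\<lbrakk>x \<in> carrier G; a \<in> powers G x; b \<in> powers G x\<rbrakk> \<Longrightarrow> a \<otimes> b \<in> powers G x"
  by (auto simp: powers_def nat_pow_mult)

lemma inv_pow_ord:
  assumes "x \<in> carrier G" "i \<le> ord x"
  shows "inv (x [^] i) = x [^] (ord x - i)"
  using assms by (intro inv_equality) (auto simp: nat_pow_mult)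

lemma inv_eq_pow:
  assumes "x \<in> carrier G" "ord x > 0"
  shows "inv x = x [^] (ord x - 1)"
  using inv_pow_ord[of x 1] assms by simp

lemma powers_inv:
  assumes "x \<in> carrier G" "ord x > 0" "a \<in> powers G x"
  shows "inv a \<in> powers G x"
proof -
  obtain i where "i < ord x" "a = x [^] i" using powers_expE[OF assms] .
  then show ?thesis using assms inv_pow_ord[of x i] by (simp add: powers_pow)
qed

lemma powers_coset_cancel:
  assumes "x \<in> carrier G" "ord x > 0" "a \<in> powers G x" "b \<in> carrier G" "b \<otimes> a \<in> powers G x"
  shows "b \<in> powers G x"
proof -
  have "a \<in> carrier G" using assms powers_subset by blast
  then have "b = (b \<otimes> a) \<otimes> inv a" using assms by (simp add: m_assoc)
  then show ?thesis using assms powers_inv powers_mult by metis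
qed

lemma powers_upto_strict:
  assumes "x \<in> carrier G" "n < m" "m < ord x"
  shows "x [^] m \<notin> powers_upto G x n"
  using assms pow_inj[of x m] by (force simp: powers_upto_def)

lemma card_powers_upto:
  assumes "x \<in> carrier G" "n < ord x"
  shows "card (powers_upto G x n) = Suc n"
proof -
  have "inj_on (\<lambda>i::nat. x [^] i) {..n}"
    using assms by (intro inj_onI) (auto intro: pow_inj)
  then show ?thesis by (simp add: powers_upto_def card_image)
qed

lemma powers_upto_saturated:
  assumes "x \<in> carrier G" "ord x > 0"
  shows "powers_upto G x (ord x) = powers_upto G x (ord x - 1)"
proof -
  have "x [^] ord x = x [^] (0::nat)" using assms by simp
  then have "x [^] ord x \<in> powers_upto G x (ord x - 1)"
    using pow_mem_powers_upto[of 0 "ord x - 1" G x] by simp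
  moreover have "powers_upto G x (ord x) = insert (x [^] ord x) (powers_upto G x (ord x - 1))"
    using assms(2) by (cases "ord x") (auto simp: powers_upto_def atMost_Suc simp del: nat_pow_Suc)
  ultimately show ?thesis by auto
qed

text \<open>
  Together with \<open>powers_upto_saturated\<close> this describes the order as the first exponent at which the powers
  of \<open>{\<one>, x}\<close> become stationary, which is a property that isomorphisms of power monoids see.
\<close>
lemma ord_le_if_saturated:
  assumes "x \<in> carrier G" "n > 0" "powers_upto G x n = powers_upto G x (n - 1)"
  shows "0 < ord x" "ord x \<le> n"
proof -
  have "x [^] n \<in> powers_upto G x (n - 1)"
    using assms(3) pow_mem_powers_upto[of n n G x] by simp
  then obtain i where i: "i \<le> n - 1" "x [^] n = x [^] i" by (auto simp: powers_upto_def)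
  have "i < n" using i(1) assms(2) by simp
  then have "x [^] (n - i) = \<one>" using pow_cancel[OF assms(1) i(2)[symmetric]] by blast
  then have "ord x dvd n - i" using assms(1) by (simp add: pow_eq_id)
  moreover have "n - i > 0" using i assms(2) by simp
  ultimately have "ord x \<le> n - i" "ord x \<noteq> 0"
    by (auto dest: dvd_imp_le intro!: gr0I)
  then show "0 < ord x" "ord x \<le> n" by auto
qed

text \<open>
  The cyclic subgroup of an element of finite order is an idempotent of the power monoid.
\<close>
lemma powers_upto_idem:
  assumes "x \<in> carrier G" "ord x > 0"
  shows "powers_upto G x (ord x - 1) <#> powers_upto G x (ord x - 1) = powers_upto G x (ord x - 1)"
proof -
  have one: "\<one> \<in> powers G x" using powers_pow[of x 0] by simp
  have "powers G x <#> powers G x = powers G x"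
  proof (rule subset_antisym; rule subsetI)
    fix z assume z: "z \<in> powers G x"
    then have "z = z \<otimes> \<one>" using powers_subset[OF assms(1)] by auto
    then show "z \<in> powers G x <#> powers G x" using z one unfolding set_mult_iff by blast
  qed (use powers_mult[OF assms(1)] in \<open>auto simp: set_mult_iff\<close>)
  then show ?thesis using powers_upto_ord[OF assms] by argo
qed

end

section \<open>Idempotents and cubes in the power monoid\<close>

context monoid
begin

text \<open>
  Inclusion in an idempotent is expressible by multiplication alone, hence preserved by isomorphisms.
\<close>
lemma stabiliser_idem:
  assumes "E \<in> carrier (power_monoid G)" "E <#> E = E" "X \<in> carrier (power_monoid G)"
  shows "X <#> E = E \<longleftrightarrow> X \<subseteq> E"
proof
  assume *: "X <#> E = E"
  show "X \<subseteq> E"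
  proof
    fix x assume x: "x \<in> X"
    then have "x = x \<otimes> \<one>" using assms by (auto simp: power_monoid_simps)
    moreover have "\<one> \<in> E" using assms by (simp add: power_monoid_simps)
    ultimately have "x \<in> X <#> E" using x unfolding set_mult_iff by blast
    then show "x \<in> E" using * by simp
  qed
next
  assume "X \<subseteq> E"
  then have "X <#> E \<subseteq> E" using mono_set_mult[of X E E E G] assms(2) by auto
  moreover have "E \<subseteq> X <#> E"
  proof
    fix x assume x: "x \<in> E"
    then have "x = \<one> \<otimes> x" using assms by (auto simp: power_monoid_simps)
    moreover have "\<one> \<in> X" using assms by (simp add: power_monoid_simps)
    ultimately show "x \<in> X <#> E" using x unfolding set_mult_iff by blast
  qed
  ultimately show "X <#> E = E" by auto
qed

lemma subsets_of_idem:
  assumes "E \<in> carrier (power_monoid G)" "E <#> E = E"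
  shows "{X. \<one> \<in> X \<and> X \<subseteq> E} = {X \<in> carrier (power_monoid G). X <#> E = E}"
proof (rule Collect_cong)
  fix X
  have "X \<in> carrier (power_monoid G)" if "\<one> \<in> X" "X \<subseteq> E"
    using that assms(1) by (auto simp: power_monoid_simps dest: finite_subset)
  moreover have "\<one> \<in> X" if "X \<in> carrier (power_monoid G)"
    using that by (simp add: power_monoid_simps)
  ultimately show "\<one> \<in> X \<and> X \<subseteq> E \<longleftrightarrow> X \<in> carrier (power_monoid G) \<and> X <#> E = E"
    using stabiliser_idem[OF assms, of X] by argo
qed

end

lemma card_subsets_containing:
  assumes "finite E" "e \<in> E"
  shows "card {X. e \<in> X \<and> X \<subseteq> E} = 2 ^ (card E - 1)"
proof -
  have "X \<in> insert e ` Pow (E - {e})" if "e \<in> X" "X \<subseteq> E" for X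
    using that by (intro image_eqI[of _ _ "X - {e}"]) auto
  then have "{X. e \<in> X \<and> X \<subseteq> E} = insert e ` Pow (E - {e})" using assms by auto
  moreover have "inj_on (insert e) (Pow (E - {e}))" by (rule inj_onI) auto
  ultimately show ?thesis using assms by (simp add: card_image card_Pow)
qed

context monoid_cancel
begin

text \<open>
  A factorization \<open>p (qr)\<close> with \<open>qr = a\<close> can be replaced by \<open>\<one> (pa)\<close>, where \<open>pa \<noteq> a\<close> by cancellation
  unless \<open>p = \<one>\<close>; in that case the product is \<open>a \<one>\<close>.  Large sets \<open>X\<close> thus have many cofactors in their cube.
\<close>
lemma cube_delete_element:
  assumes X: "X \<in> carrier (power_monoid G)" and a: "a \<in> X" "a \<noteq> \<one>"
  shows "X <#> ((X <#> X) - {a}) = X <#> (X <#> X)"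
proof (rule subset_antisym; rule subsetI)
  fix z assume "z \<in> X <#> (X <#> X)"
  then obtain p q r where z: "p \<in> X" "q \<in> X" "r \<in> X" "z = p \<otimes> (q \<otimes> r)"
    by (auto simp: set_mult_iff)
  have c: "p \<in> carrier G" "q \<in> carrier G" "r \<in> carrier G" "a \<in> carrier G" "\<one> \<in> X"
    using X z a by (auto simp: power_monoid_simps)
  have qr: "q \<otimes> r \<in> X <#> X" using z set_mult_iff by metis
  consider "q \<otimes> r \<noteq> a" | "q \<otimes> r = a" "p = \<one>" | "q \<otimes> r = a" "p \<noteq> \<one>" by blast
  then show "z \<in> X <#> ((X <#> X) - {a})"
  proof cases
    case 1
    then show ?thesis using z(1,4) qr unfolding set_mult_iff[of z] by blast
  next
    case 2
    have "\<one> \<in> X <#> X" using c(5) c(1) unfolding set_mult_iff by (metis one_closed r_one)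
    moreover have "z = a \<otimes> \<one>" using 2 z(4) c by simp
    ultimately show ?thesis using a unfolding set_mult_iff[of z] by blast
  next
    case 3
    have "p \<otimes> a \<noteq> a" using 3 c r_cancel[of p a \<one>] by auto
    moreover have "p \<otimes> a \<in> X <#> X" using z(1) a(1) set_mult_iff by metis
    moreover have "z = \<one> \<otimes> (p \<otimes> a)" using 3 z(4) c by simp
    ultimately show ?thesis using c(5) unfolding set_mult_iff[of z] by blast
  qed
qed (auto simp: set_mult_iff)

text \<open>
  The powers of \<open>y\<close> are distinct, so exponents behave like degrees: \<open>Z\<close> must contain \<open>y\<^sup>2\<close>
  to produce \<open>y\<^sup>3\<close>, and it cannot contain \<open>y\<^sup>3\<close>, which would produce \<open>y\<^sup>4\<close>.
\<close>
lemma cofactors_of_pair_in_cube: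
  assumes y: "y \<in> carrier G" "\<And>n::nat. n > 0 \<Longrightarrow> y [^] n \<noteq> \<one>"
    and Z: "Z \<in> carrier (power_monoid G)" "{\<one>, y} <#> Z = powers_upto G y 3"
  shows "Z = powers_upto G y 2 \<or> Z = {\<one>, y [^] (2::nat)}"
proof -
  have inj: "i = j" if "y [^] i = y [^] j" for i j :: nat
    using pow_cancel[OF y(1), of i j] pow_cancel[OF y(1), of j i] y(2)[of "i - j"] y(2)[of "j - i"] that
    by (metis linorder_neqE_nat zero_less_diff)
  have P: "z \<in> powers_upto G y 3 \<longleftrightarrow> z = \<one> \<or> (\<exists>z'\<in>Z. z = y \<otimes> z') \<or> z \<in> Z" for z
    using Z by (auto simp flip: Z(2) simp: set_mult_iff power_monoid_simps subset_iff)
  have exp: "\<exists>i\<le>2. z = y [^] (i::nat)" if z: "z \<in> Z" for z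
  proof -
    obtain i :: nat where i: "i \<le> 3" "z = y [^] i" using P z by (auto simp: powers_upto_def)
    have "y \<otimes> z = y [^] Suc i" using i y(1) by (metis nat_pow_Suc2)
    moreover obtain j :: nat where "j \<le> 3" "y \<otimes> z = y [^] j" using P z by (auto simp: powers_upto_def)
    ultimately have "i \<noteq> 3" using inj[of "Suc i" j] by auto
    then show ?thesis using i by (intro exI[of _ i]) auto
  qed
  have "y [^] (3::nat) \<in> powers_upto G y 3" by (simp add: powers_upto_def)
  then have "(\<exists>z'\<in>Z. y [^] (3::nat) = y \<otimes> z') \<or> y [^] (3::nat) \<in> Z"
    using P inj[of 3 0] by auto
  moreover have "y [^] (3::nat) \<notin> Z"
  proof
    assume "y [^] (3::nat) \<in> Z"
    then obtain i :: nat where "i \<le> 2" "y [^] (3::nat) = y [^] i" using exp by blast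
    then show False using inj[of 3 i] by auto
  qed
  ultimately obtain z where z: "z \<in> Z" "y [^] (3::nat) = y \<otimes> z" by blast
  then obtain i :: nat where i: "i \<le> 2" "z = y [^] i" using exp by blast
  then have "y [^] (3::nat) = y [^] Suc i" using z y(1) by (metis nat_pow_Suc2)
  then have "i = 2" using inj[of 3 "Suc i"] by auto
  then have sq: "y [^] (2::nat) \<in> Z" using i z by simp
  have one: "\<one> \<in> Z" using Z by (simp add: power_monoid_simps)
  have p: "powers_upto G y 2 = {\<one>, y, y [^] (2::nat)}"
    using y(1) by (auto simp: powers_upto_def numeral_2_eq_2 atMost_Suc)
  have "Z \<subseteq> {\<one>, y, y [^] (2::nat)}"
    using exp p by (fastforce simp flip: p simp: powers_upto_def)
  then show ?thesis using sq one p by auto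
qed

end

section \<open>Isomorphisms of power monoids and the images of pairs\<close>

locale power_iso = H: monoid H + K: monoid K
  for H :: "('a, 'm) monoid_scheme" and K :: "('b, 'n) monoid_scheme" +
  fixes f :: "'a set \<Rightarrow> 'b set"
  assumes f_iso: "f \<in> iso (power_monoid H) (power_monoid K)"
begin

lemma f_closed: "X \<in> carrier (power_monoid H) \<Longrightarrow> f X \<in> carrier (power_monoid K)"
  using f_iso by (auto simp: iso_def hom_def)

lemma f_mult:
  "\<lbrakk>X \<in> carrier (power_monoid H); Y \<in> carrier (power_monoid H)\<rbrakk> \<Longrightarrow> f (X <#>\<^bsub>H\<^esub> Y) = f X <#>\<^bsub>K\<^esub> f Y"
  using f_iso by (auto simp: iso_def hom_def power_monoid_simps)

lemma f_inj:
  "\<lbrakk>X \<in> carrier (power_monoid H); Y \<in> carrier (power_monoid H); f X = f Y\<rbrakk> \<Longrightarrow> X = Y"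
  using f_iso by (auto simp: iso_def bij_betw_def dest: inj_onD)

lemma f_surj:
  assumes "Y \<in> carrier (power_monoid K)"
  obtains X where "X \<in> carrier (power_monoid H)" "f X = Y"
proof -
  have "Y \<in> f ` carrier (power_monoid H)"
    using f_iso assms by (simp add: iso_def bij_betw_def)
  then show ?thesis using that by blast
qed

lemma f_one: "f {\<one>\<^bsub>H\<^esub>} = {\<one>\<^bsub>K\<^esub>}"
proof -
  interpret PH: monoid "power_monoid H" by (rule power_monoid_is_monoid) (rule H.monoid_axioms)
  interpret PK: monoid "power_monoid K" by (rule power_monoid_is_monoid) (rule K.monoid_axioms)
  obtain X where X: "X \<in> carrier (power_monoid H)" "f X = {\<one>\<^bsub>K\<^esub>}"
    using f_surj[of "{\<one>\<^bsub>K\<^esub>}"] PK.one_closed by (auto simp: power_monoid_simps(3))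
  have one: "{\<one>\<^bsub>H\<^esub>} \<in> carrier (power_monoid H)" using PH.one_closed by (simp add: power_monoid_simps(3))
  have "f {\<one>\<^bsub>H\<^esub>} = f {\<one>\<^bsub>H\<^esub>} <#>\<^bsub>K\<^esub> f X"
    using PK.r_one[OF f_closed[OF one]] X by (simp add: power_monoid_simps(2,3))
  also have "\<dots> = f ({\<one>\<^bsub>H\<^esub>} <#>\<^bsub>H\<^esub> X)" using f_mult[OF one X(1)] by simp
  also have "\<dots> = f X" using PH.l_one[OF X(1)] by (simp add: power_monoid_simps(2,3))
  finally show ?thesis using X by simp
qed

lemma inverse_power_iso: "power_iso K H (inv_into (carrier (power_monoid H)) f)"
proof
  let ?h = "inv_into (carrier (power_monoid H)) f"
  have bij: "bij_betw f (carrier (power_monoid H)) (carrier (power_monoid K))"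
    using f_iso by (simp add: iso_def)
  have hc: "?h Y \<in> carrier (power_monoid H)" "f (?h Y) = Y" if "Y \<in> carrier (power_monoid K)" for Y
    using that bij by (simp_all add: bij_betw_def inv_into_into f_inv_into_f)
  show "?h \<in> iso (power_monoid K) (power_monoid H)"
  proof (rule isoI)
    show "bij_betw ?h (carrier (power_monoid K)) (carrier (power_monoid H))"
      using bij by (rule bij_betw_inv_into)
    show "?h \<in> hom (power_monoid K) (power_monoid H)"
    proof (rule homI)
      fix X Y assume XY: "X \<in> carrier (power_monoid K)" "Y \<in> carrier (power_monoid K)"
      have "f (?h X <#>\<^bsub>H\<^esub> ?h Y) = X <#>\<^bsub>K\<^esub> Y" using f_mult hc XY by simp
      also have "\<dots> = f (?h (X <#>\<^bsub>K\<^esub> Y))" using hc K.mult_closed_power_monoid XY by simp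
      finally show "?h (X \<otimes>\<^bsub>power_monoid K\<^esub> Y) = ?h X \<otimes>\<^bsub>power_monoid H\<^esub> ?h Y"
        using f_inj hc XY K.mult_closed_power_monoid H.mult_closed_power_monoid
        by (metis power_monoid_simps(2))
    qed (use hc in simp)
  qed
qed

text \<open>
  The solutions \<open>X\<close> of \<open>XE = E\<close> are counted by \<open>2\<close> to the power \<open>|E| - 1\<close>, and \<open>f\<close> matches them with the
  solutions of the corresponding equation for \<open>f E\<close>.
\<close>
lemma card_idem:
  assumes "E \<in> carrier (power_monoid H)" "E <#>\<^bsub>H\<^esub> E = E"
  shows "card (f E) = card E"
proof -
  let ?S = "{X. \<one>\<^bsub>H\<^esub> \<in> X \<and> X \<subseteq> E}" and ?T = "{Y. \<one>\<^bsub>K\<^esub> \<in> Y \<and> Y \<subseteq> f E}"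
  have F: "f E \<in> carrier (power_monoid K)" "f E <#>\<^bsub>K\<^esub> f E = f E"
    using assms f_closed f_mult by metis+
  have fin: "finite E" "finite (f E)" "\<one>\<^bsub>H\<^esub> \<in> E" "\<one>\<^bsub>K\<^esub> \<in> f E"
    using assms F by (simp_all add: power_monoid_simps)
  note S = H.subsets_of_idem[OF assms] and T = K.subsets_of_idem[OF F]
  have "X <#>\<^bsub>H\<^esub> E = E \<longleftrightarrow> f X <#>\<^bsub>K\<^esub> f E = f E" if "X \<in> carrier (power_monoid H)" for X
    using f_mult[OF that assms(1)] f_inj[OF H.mult_closed_power_monoid[OF that assms(1)] assms(1)] by argo
  note stab = this
  have "f ` ?S = ?T"
  proof (rule subset_antisym; rule subsetI)
    fix Y assume "Y \<in> f ` ?S"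
    then show "Y \<in> ?T" unfolding S T using stab f_closed by blast
  next
    fix Y assume Y: "Y \<in> ?T"
    then obtain X where "X \<in> carrier (power_monoid H)" "f X = Y"
      unfolding T using f_surj by blast
    then show "Y \<in> f ` ?S" using Y stab unfolding S T by blast
  qed
  moreover have "inj_on f ?S" unfolding S using f_inj by (intro inj_onI) blast
  ultimately have "card ?S = card ?T" by (metis card_image)
  then have "card E - 1 = card (f E) - 1"
    using fin by (simp add: card_subsets_containing)
  moreover have "card E > 0" "card (f E) > 0" using fin by (auto simp: card_gt_0_iff)
  ultimately show ?thesis by simp
qed

lemma f_powers_upto_if_pair:
  assumes "x \<in> carrier H" "y \<in> carrier K" "f {\<one>\<^bsub>H\<^esub>, x} = {\<one>\<^bsub>K\<^esub>, y}"
  shows "f (powers_upto H x n) = powers_upto K y n"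
proof (induction n)
  case 0
  show ?case by (simp add: H.powers_upto_0 K.powers_upto_0 f_one)
next
  case (Suc n)
  then show ?case
    using assms f_mult[OF H.powers_upto_closed[OF assms(1)] H.pair_closed[OF assms(1)]]
    by (simp add: H.powers_upto_Suc K.powers_upto_Suc)
qed

text \<open>
  Let \<open>x \<noteq> \<one>\<close> have order \<open>n\<close>.  Up to exponent \<open>n - 1\<close>, the powers of \<open>{\<one>, x}\<close> are distinct, hence so are those of its
  image \<open>Y\<close>, which form an increasing chain.  It ends in the image of the subgroup generated by \<open>x\<close> and has \<open>n - 2\<close> strict steps from \<open>Y\<close> to a set
  of \<open>n\<close> elements, so \<open>Y\<close> has at most two elements.
\<close>
lemma image_of_pair:
  assumes "group H" "x \<in> carrier H" "group.ord H x > 0"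
  shows "\<exists>y\<in>carrier K. f {\<one>\<^bsub>H\<^esub>, x} = {\<one>\<^bsub>K\<^esub>, y}"
proof -
  interpret H: group H by fact
  let ?n = "H.ord x" and ?S = "\<lambda>m. f (powers_upto H x m)" and ?Y = "f {\<one>\<^bsub>H\<^esub>, x}"
  have Y: "?Y \<subseteq> carrier K" "finite ?Y" "\<one>\<^bsub>K\<^esub> \<in> ?Y"
    using f_closed[OF H.pair_closed[OF assms(2)]] by (simp_all add: power_monoid_simps)
  have Scl: "?S m \<subseteq> carrier K" "finite (?S m)" for m
    using f_closed[OF H.powers_upto_closed[OF assms(2), of m]] by (simp_all add: power_monoid_simps)
  have step: "?S (Suc m) = ?S m <#>\<^bsub>K\<^esub> ?Y" for m
    using f_mult[OF H.powers_upto_closed[OF assms(2)] H.pair_closed[OF assms(2)]]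
    by (simp add: H.powers_upto_Suc assms(2))
  have less: "card (?S m) < card (?S (Suc m))" if "Suc m < ?n" for m
  proof (rule psubset_card_mono)
    have "?S m \<subseteq> ?S (Suc m)"
    proof
      fix z assume "z \<in> ?S m"
      moreover have "z = z \<otimes>\<^bsub>K\<^esub> \<one>\<^bsub>K\<^esub>"
        using calculation Scl(1)[of m] by (metis K.r_one subsetD)
      ultimately show "z \<in> ?S (Suc m)" unfolding step set_mult_iff using Y by blast
    qed
    moreover have "powers_upto H x m \<noteq> powers_upto H x (Suc m)"
      using H.powers_upto_strict[OF assms(2) lessI that] pow_mem_powers_upto[of "Suc m" "Suc m" H x] by auto
    then have "?S m \<noteq> ?S (Suc m)"
      using f_inj[OF H.powers_upto_closed[OF assms(2)] H.powers_upto_closed[OF assms(2)]] by blast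
    ultimately show "?S m \<subset> ?S (Suc m)" by blast
  qed (use Scl in simp)
  \<comment> \<open>At \<open>m = n - 2\<close>, where the power has \<open>n\<close> elements, this bounds the size of \<open>Y\<close> by two.\<close>
  have grow: "card ?Y + m \<le> card (?S (Suc m))" if "Suc m < ?n" for m
    using that
  proof (induction m)
    case 0
    show ?case using H.powers_upto_1[OF assms(2)] by simp
  next
    case (Suc m)
    then show ?case using less[of "Suc m"] by simp
  qed
  have card: "card (?S (?n - 1)) = ?n"
    using card_idem[OF H.powers_upto_closed[OF assms(2)] H.powers_upto_idem[OF assms(2,3)]]
      H.card_powers_upto[OF assms(2)] assms(3) by simp
  show ?thesis
  proof (cases "?n = 1")
    case True
    then have "x = \<one>\<^bsub>H\<^esub>" using H.ord_eq_1[OF assms(2)] by simp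
    then show ?thesis using f_one by (intro bexI[of _ "\<one>\<^bsub>K\<^esub>"]) auto
  next
    case False
    then have "card ?Y + (?n - 2) \<le> ?n" using grow[of "?n - 2"] card assms(3)
      by (simp add: numeral_2_eq_2 Suc_diff_Suc)
    then have "card ?Y \<le> 2" using False assms(3) by linarith
    then have "card (?Y - {\<one>\<^bsub>K\<^esub>}) \<le> 1" using Y by simp
    then consider "?Y - {\<one>\<^bsub>K\<^esub>} = {}" | y where "?Y - {\<one>\<^bsub>K\<^esub>} = {y}"
      using Y(2) by (metis card_1_singletonE card_eq_0_iff finite_Diff le_SucE le_zero_eq One_nat_def)
    then show ?thesis
    proof cases
      case 1
      then show ?thesis using Y by (intro bexI[of _ "\<one>\<^bsub>K\<^esub>"]) auto
    next
      case 2
      then show ?thesis using Y by (intro bexI[of _ y]) auto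
    qed
  qed
qed

text \<open>
  Let \<open>X\<close> be the preimage of \<open>{\<one>, y}\<close>, with \<open>y\<close> of infinite order.  Each \<open>X\<^sup>2 - {a}\<close> with \<open>a \<noteq> \<one>\<close> in \<open>X\<close> is a
  cofactor of \<open>X\<close> in \<open>X\<^sup>3\<close> other than \<open>X\<^sup>2\<close>, and its image can only be \<open>{\<one>, y\<^sup>2}\<close>; so there is just
  one such \<open>a\<close>.  But \<open>a\<close> has finite order, and the powers of \<open>{\<one>, a}\<close> become stationary.
\<close>
lemma finite_period_transfer:
  assumes H: "group H" "\<And>x. x \<in> carrier H \<Longrightarrow> group.ord H x > 0"
    and K: "monoid_cancel K" and y: "y \<in> carrier K"
  shows "\<exists>n>0. y [^]\<^bsub>K\<^esub> (n::nat) = \<one>\<^bsub>K\<^esub>"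
proof (rule ccontr)
  assume neg: "\<not> ?thesis"
  then have inf: "y [^]\<^bsub>K\<^esub> n \<noteq> \<one>\<^bsub>K\<^esub>" if "n > 0" for n :: nat using that by blast
  interpret H: group H by fact
  interpret K: monoid_cancel K by fact
  obtain X where X: "X \<in> carrier (power_monoid H)" "f X = {\<one>\<^bsub>K\<^esub>, y}"
    using f_surj[OF K.pair_closed[OF y]] .
  have XX: "X <#>\<^bsub>H\<^esub> X \<in> carrier (power_monoid H)"
    using H.mult_closed_power_monoid X by blast
  have fXX: "f (X <#>\<^bsub>H\<^esub> X) = powers_upto K y 2"
    using f_mult X K.powers_upto_add[OF y, of 1 1] K.powers_upto_1[OF y] by (simp add: numeral_2_eq_2)
  have X1: "\<one>\<^bsub>H\<^esub> \<in> X" "X \<subseteq> carrier H" using X by (simp_all add: power_monoid_simps)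
  have sub: "X \<subseteq> X <#>\<^bsub>H\<^esub> X"
  proof
    fix a assume "a \<in> X"
    moreover have "a = a \<otimes>\<^bsub>H\<^esub> \<one>\<^bsub>H\<^esub>" using calculation X1 by auto
    ultimately show "a \<in> X <#>\<^bsub>H\<^esub> X" using X1 unfolding set_mult_iff by blast
  qed
  have del: "(X <#>\<^bsub>H\<^esub> X) - {a} \<in> carrier (power_monoid H)"
    "f ((X <#>\<^bsub>H\<^esub> X) - {a}) = {\<one>\<^bsub>K\<^esub>, y [^]\<^bsub>K\<^esub> (2::nat)}" if a: "a \<in> X" "a \<noteq> \<one>\<^bsub>H\<^esub>" for a
  proof -
    let ?Z = "(X <#>\<^bsub>H\<^esub> X) - {a}"
    show Z: "?Z \<in> carrier (power_monoid H)"
      using XX X1 sub a by (auto simp: power_monoid_simps)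
    have "{\<one>\<^bsub>K\<^esub>, y} <#>\<^bsub>K\<^esub> f ?Z = f (X <#>\<^bsub>H\<^esub> (X <#>\<^bsub>H\<^esub> X))"
      using f_mult[OF X(1) Z] H.cube_delete_element[OF X(1) a] X(2) by simp
    also have "\<dots> = powers_upto K y 3"
      using f_mult[OF X(1) XX] fXX X(2) K.powers_upto_add[OF y, of 1 2] K.powers_upto_1[OF y] by (simp add: eval_nat_numeral)
    finally have "f ?Z = powers_upto K y 2 \<or> f ?Z = {\<one>\<^bsub>K\<^esub>, y [^]\<^bsub>K\<^esub> (2::nat)}"
      using K.cofactors_of_pair_in_cube[OF y inf f_closed[OF Z]] by blast
    moreover have "f ?Z \<noteq> powers_upto K y 2"
    proof
      assume "f ?Z = powers_upto K y 2"
      then have "?Z = X <#>\<^bsub>H\<^esub> X" using f_inj[OF Z XX] fXX by simp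
      then show False using a sub by blast
    qed
    ultimately show "f ?Z = {\<one>\<^bsub>K\<^esub>, y [^]\<^bsub>K\<^esub> (2::nat)}" by blast
  qed
  have uniq: "a = b" if "a \<in> X" "a \<noteq> \<one>\<^bsub>H\<^esub>" "b \<in> X" "b \<noteq> \<one>\<^bsub>H\<^esub>" for a b
  proof -
    have "(X <#>\<^bsub>H\<^esub> X) - {a} = (X <#>\<^bsub>H\<^esub> X) - {b}"
      using f_inj[OF del(1) del(1)] del(2) that by metis
    then show ?thesis using that sub by blast
  qed
  have "y \<noteq> \<one>\<^bsub>K\<^esub>" using inf[of 1] y by auto
  then have "X \<noteq> {\<one>\<^bsub>H\<^esub>}" using X f_one by auto
  then obtain a where a: "a \<in> X" "a \<noteq> \<one>\<^bsub>H\<^esub>" using X1 by blast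
  then have Xa: "X = {\<one>\<^bsub>H\<^esub>, a}" using uniq X1 by blast
  have ac: "a \<in> carrier H" using a X1 by blast
  let ?n = "H.ord a"
  have n: "?n > 0" using H(2) ac by blast
  have seg: "f (powers_upto H a m) = powers_upto K y m" for m
    using f_powers_upto_if_pair[OF ac y] X(2) Xa by simp
  have "powers_upto H a ?n = powers_upto H a (?n - 1)" by (rule H.powers_upto_saturated[OF ac n])
  then have "powers_upto K y ?n = powers_upto K y (?n - 1)" using seg by metis
  then have "y [^]\<^bsub>K\<^esub> ?n \<in> powers_upto K y (?n - 1)"
    using pow_mem_powers_upto[of ?n ?n K y] by simp
  then obtain i where "i \<le> ?n - 1" "y [^]\<^bsub>K\<^esub> i = y [^]\<^bsub>K\<^esub> ?n" by (auto simp: powers_upto_def)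
  moreover from this n have "i < ?n" by linarith
  ultimately show False using K.pow_cancel[OF y, of i ?n] inf[of "?n - i"] by auto
qed

end

lemma (in power_iso) torsion_transfer:
  assumes "monoid_cancel H" "monoid_cancel K" "torsion_monoid H"
  shows "group H" "\<And>x. x \<in> carrier H \<Longrightarrow> group.ord H x > 0"
    "group K" "\<And>y. y \<in> carrier K \<Longrightarrow> group.ord K y > 0"
proof -
  interpret Hc: monoid_cancel H by fact
  interpret Kc: monoid_cancel K by fact
  have perH: "\<exists>n>0. x [^]\<^bsub>H\<^esub> (n::nat) = \<one>\<^bsub>H\<^esub>" if "x \<in> carrier H" for x
    using Hc.torsion_elem_period that assms(3) by (simp add: torsion_monoid_def)
  show gH: "group H" using Hc.group_if_periodic perH by blast
  show oH: "group.ord H x > 0" if "x \<in> carrier H" for x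
    using group.ord_eq_0[OF gH that] perH[OF that] by auto
  have perK: "\<exists>n>0. y [^]\<^bsub>K\<^esub> (n::nat) = \<one>\<^bsub>K\<^esub>" if "y \<in> carrier K" for y
    using finite_period_transfer[OF gH oH assms(2) that] .
  show gK: "group K" using Kc.group_if_periodic perK by blast
  show "group.ord K y > 0" if "y \<in> carrier K" for y
    using group.ord_eq_0[OF gK that] perK[OF that] by auto
qed

section \<open>The pullback on cyclic subgroups\<close>

text \<open>
  The situation after torsion has been transferred and pairs are known to go to pairs.
\<close>
locale torsion_power_iso = power_iso H K f + H: group H + K: group K
  for H :: "('a, 'm) monoid_scheme" and K :: "('b, 'n) monoid_scheme" and f +
  fixes g :: "'a \<Rightarrow> 'b"
  assumes ord_pos: "x \<in> carrier H \<Longrightarrow> H.ord x > 0"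
    and g_closed: "x \<in> carrier H \<Longrightarrow> g x \<in> carrier K"
    and g_pair: "x \<in> carrier H \<Longrightarrow> f {\<one>\<^bsub>H\<^esub>, x} = {\<one>\<^bsub>K\<^esub>, g x}"
begin

lemma g_powers_upto:
  "x \<in> carrier H \<Longrightarrow> f (powers_upto H x n) = powers_upto K (g x) n"
  using f_powers_upto_if_pair g_closed g_pair by blast

lemma g_inj: "\<lbrakk>x \<in> carrier H; y \<in> carrier H; g x = g y\<rbrakk> \<Longrightarrow> x = y"
  using f_inj[OF H.pair_closed H.pair_closed, of x y] g_pair
  by (auto simp: doubleton_eq_iff)

lemma g_one: "g \<one>\<^bsub>H\<^esub> = \<one>\<^bsub>K\<^esub>"
  using g_pair[of "\<one>\<^bsub>H\<^esub>"] f_one by (auto simp: doubleton_eq_iff)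

lemma g_powers_upto_eq_iff:
  assumes "x \<in> carrier H"
  shows "powers_upto K (g x) m = powers_upto K (g x) n \<longleftrightarrow> powers_upto H x m = powers_upto H x n"
  using f_inj[OF H.powers_upto_closed[OF assms] H.powers_upto_closed[OF assms], of m n]
  by (auto simp flip: g_powers_upto[OF assms])

lemma ord_g:
  assumes "x \<in> carrier H"
  shows "K.ord (g x) = H.ord x"
proof (rule antisym)
  have "powers_upto K (g x) (H.ord x) = powers_upto K (g x) (H.ord x - 1)"
    using H.powers_upto_saturated[OF assms ord_pos[OF assms]] g_powers_upto_eq_iff[OF assms] by blast
  then have *: "0 < K.ord (g x)" "K.ord (g x) \<le> H.ord x"
    using K.ord_le_if_saturated[OF g_closed[OF assms] ord_pos[OF assms]] by blast+
  then show "K.ord (g x) \<le> H.ord x" by blast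
  have "powers_upto H x (K.ord (g x)) = powers_upto H x (K.ord (g x) - 1)"
    using K.powers_upto_saturated[OF g_closed[OF assms] *(1)] g_powers_upto_eq_iff[OF assms] by blast
  then show "H.ord x \<le> K.ord (g x)"
    using H.ord_le_if_saturated[OF assms *(1)] by blast
qed

lemma ord_g_pos: "x \<in> carrier H \<Longrightarrow> K.ord (g x) > 0"
  by (simp add: ord_g ord_pos)

lemma f_powers: "x \<in> carrier H \<Longrightarrow> f (powers H x) = powers K (g x)"
  using g_powers_upto[of x "H.ord x - 1"] H.powers_upto_ord[of x] K.powers_upto_ord[of "g x"]
  by (simp add: ord_g ord_pos g_closed)

lemma powers_in_power_monoid: "x \<in> carrier H \<Longrightarrow> powers H x \<in> carrier (power_monoid H)"
  using H.powers_upto_closed[of x "H.ord x - 1"] H.powers_upto_ord[of x] by (simp add: ord_pos)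

text \<open>
  Membership of \<open>z\<close> in the cyclic subgroup \<open>E\<close> of \<open>y\<close> means \<open>{\<one>, z} E = E\<close>.
\<close>
lemma g_mem_powers_iff:
  assumes y: "y \<in> carrier H" and z: "z \<in> carrier H"
  shows "g z \<in> powers K (g y) \<longleftrightarrow> z \<in> powers H y"
proof -
  have E: "powers H y \<in> carrier (power_monoid H)" by (rule powers_in_power_monoid[OF y])
  have EE: "powers H y <#>\<^bsub>H\<^esub> powers H y = powers H y"
    using H.powers_upto_idem[OF y ord_pos[OF y]] H.powers_upto_ord[OF y ord_pos[OF y]] by argo
  have F: "powers K (g y) \<in> carrier (power_monoid K)" using f_closed[OF E] f_powers[OF y] by simp
  have FF: "powers K (g y) <#>\<^bsub>K\<^esub> powers K (g y) = powers K (g y)"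
    using f_mult[OF E E] EE f_powers[OF y] by simp
  have one: "\<one>\<^bsub>H\<^esub> \<in> powers H y" "\<one>\<^bsub>K\<^esub> \<in> powers K (g y)"
    using E F by (simp_all add: power_monoid_simps)
  have "z \<in> powers H y \<longleftrightarrow> {\<one>\<^bsub>H\<^esub>, z} <#>\<^bsub>H\<^esub> powers H y = powers H y"
    using H.stabiliser_idem[OF E EE H.pair_closed[OF z]] one by simp
  also have "\<dots> \<longleftrightarrow> {\<one>\<^bsub>K\<^esub>, g z} <#>\<^bsub>K\<^esub> powers K (g y) = powers K (g y)"
    using f_mult[OF H.pair_closed[OF z] E] g_pair[OF z] f_powers[OF y]
      f_inj[OF H.mult_closed_power_monoid[OF H.pair_closed[OF z] E] E] by argo
  also have "\<dots> \<longleftrightarrow> g z \<in> powers K (g y)"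
    using K.stabiliser_idem[OF F FF K.pair_closed[OF g_closed[OF z]]] one by simp
  finally show ?thesis by blast
qed

lemma f_pair_powers_upto:
  assumes "w \<in> carrier H" "x \<in> carrier H"
  shows "f ({\<one>\<^bsub>H\<^esub>, w} <#>\<^bsub>H\<^esub> powers_upto H x n) = {\<one>\<^bsub>K\<^esub>, g w} <#>\<^bsub>K\<^esub> powers_upto K (g x) n"
  using f_mult[OF H.pair_closed[OF assms(1)] H.powers_upto_closed[OF assms(2)]]
    g_pair[OF assms(1)] g_powers_upto[OF assms(2)] by simp

lemma g_pow_exp:
  assumes "x \<in> carrier H" "z \<in> powers H x"
  obtains i where "i < H.ord x" "g z = g x [^]\<^bsub>K\<^esub> (i::nat)"
proof -
  have "z \<in> carrier H" using assms H.powers_subset by blast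
  then have "g z \<in> powers K (g x)" using assms g_mem_powers_iff by blast
  then show ?thesis
    using K.powers_expE[OF g_closed[OF assms(1)] ord_g_pos[OF assms(1)]] ord_g[OF assms(1)] that by metis
qed

text \<open>
  With \<open>n \<ge> 3\<close> the order of \<open>x\<close>, the product of \<open>{\<one>, x\<^sup>-\<^sup>1}\<close> and \<open>{\<one>, x}\<^sup>n\<^sup>-\<^sup>3\<close> omits \<open>x\<^sup>n\<^sup>-\<^sup>2\<close>.  In the cyclic group
  of \<open>g x\<close>, replacing \<open>x\<^sup>-\<^sup>1\<close> by a power with exponent strictly between \<open>1\<close> and \<open>n - 1\<close> would yield the whole group.
\<close>
lemma g_inv:
  assumes x: "x \<in> carrier H"
  shows "g (inv\<^bsub>H\<^esub> x) = inv\<^bsub>K\<^esub> (g x)"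
proof (cases "H.ord x \<le> 2")
  case True
  then consider "H.ord x = 1" | "H.ord x = 2" using ord_pos[OF x] by linarith
  then show ?thesis
  proof cases
    case 1
    then show ?thesis using H.ord_eq_1[OF x] g_one by simp
  next
    case 2
    then have "inv\<^bsub>H\<^esub> x = x" "inv\<^bsub>K\<^esub> (g x) = g x"
      using H.inv_eq_pow[OF x] K.inv_eq_pow[OF g_closed[OF x]] x g_closed[OF x] ord_g[OF x] by simp_all
    then show ?thesis by simp
  qed
next
  case False
  let ?n = "H.ord x" and ?u = "g x"
  \<comment> \<open>Since \<open>n = m + 3\<close>, the claim is that the exponent \<open>z\<close> of \<open>g (x\<^sup>-\<^sup>1)\<close> equals \<open>m + 2\<close>.\<close>
  define m where "m = ?n - 3"
  have n: "?n = m + 3" using False by (simp add: m_def)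
  have u: "?u \<in> carrier K" "K.ord ?u = ?n" using g_closed[OF x] ord_g[OF x] by auto
  have ix: "inv\<^bsub>H\<^esub> x = x [^]\<^bsub>H\<^esub> (m + 2)" using H.inv_eq_pow[OF x] n by simp
  have ixc: "inv\<^bsub>H\<^esub> x \<in> carrier H" using x by simp
  obtain z where z: "z < ?n" "g (inv\<^bsub>H\<^esub> x) = ?u [^]\<^bsub>K\<^esub> z"
    using g_pow_exp[OF x, of "inv\<^bsub>H\<^esub> x"] ix H.powers_pow by metis
  have "z \<noteq> 0"
  proof
    assume "z = 0"
    then have "g (inv\<^bsub>H\<^esub> x) = g \<one>\<^bsub>H\<^esub>" using z g_one by simp
    then have "inv\<^bsub>H\<^esub> x = \<one>\<^bsub>H\<^esub>" using g_inj ixc by blast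
    then show False using x n H.ord_eq_1[OF x] by auto
  qed
  moreover have "z \<noteq> 1"
  proof
    assume "z = 1"
    then have "g (inv\<^bsub>H\<^esub> x) = g x" using z u by simp
    then have "x [^]\<^bsub>H\<^esub> (m + 2) = x [^]\<^bsub>H\<^esub> (1::nat)" using g_inj ixc x ix by simp
    then show False using H.pow_inj[OF x] n by fastforce
  qed
  moreover have "z \<ge> m + 2"
  proof (rule ccontr)
    assume "\<not> ?thesis"
    then have zz: "2 \<le> z" "z \<le> m + 1" using calculation by auto
    have "{\<one>\<^bsub>K\<^esub>, g (inv\<^bsub>H\<^esub> x)} <#>\<^bsub>K\<^esub> powers_upto K ?u m = powers_upto K ?u (m + 2)"
    proof (rule subset_antisym; rule subsetI)
      fix w assume "w \<in> {\<one>\<^bsub>K\<^esub>, g (inv\<^bsub>H\<^esub> x)} <#>\<^bsub>K\<^esub> powers_upto K ?u m"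
      then obtain j :: nat where "w = ?u [^]\<^bsub>K\<^esub> j \<or> w = ?u [^]\<^bsub>K\<^esub> z \<otimes>\<^bsub>K\<^esub> ?u [^]\<^bsub>K\<^esub> j"
        using K.pair_powers_upto_iff[OF g_closed[OF ixc] u(1)] z by auto
      then have "w \<in> powers K ?u" using u by (auto simp: K.nat_pow_mult K.powers_pow)
      then show "w \<in> powers_upto K ?u (m + 2)"
        using K.powers_upto_ord[OF u(1)] u(2) n by simp
    next
      fix w assume "w \<in> powers_upto K ?u (m + 2)"
      then obtain i where i: "i \<le> m + 2" "w = ?u [^]\<^bsub>K\<^esub> i" by (auto simp: powers_upto_def)
      have "i \<le> m \<or> z \<le> i \<and> i - z \<le> m" using zz i by linarith
      moreover have "w = ?u [^]\<^bsub>K\<^esub> z \<otimes>\<^bsub>K\<^esub> ?u [^]\<^bsub>K\<^esub> (i - z)" if "z \<le> i"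
        using that i u by (simp add: K.nat_pow_mult)
      ultimately show "w \<in> {\<one>\<^bsub>K\<^esub>, g (inv\<^bsub>H\<^esub> x)} <#>\<^bsub>K\<^esub> powers_upto K ?u m"
        using K.pair_powers_upto_iff[OF g_closed[OF ixc] u(1)] z i by metis
    qed
    then have "{\<one>\<^bsub>H\<^esub>, inv\<^bsub>H\<^esub> x} <#>\<^bsub>H\<^esub> powers_upto H x m = powers_upto H x (m + 2)"
      using f_pair_powers_upto[OF ixc x] g_powers_upto[OF x]
        f_inj[OF H.mult_closed_power_monoid[OF H.pair_closed[OF ixc] H.powers_upto_closed[OF x]] H.powers_upto_closed[OF x]]
      by metis
    then have "x [^]\<^bsub>H\<^esub> (m + 1) \<in> {\<one>\<^bsub>H\<^esub>, inv\<^bsub>H\<^esub> x} <#>\<^bsub>H\<^esub> powers_upto H x m"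
      using pow_mem_powers_upto[of "m + 1" "m + 2" H x] by simp
    then obtain j where j: "j \<le> m" "x [^]\<^bsub>H\<^esub> (m + 1) = x [^]\<^bsub>H\<^esub> j \<or> x [^]\<^bsub>H\<^esub> (m + 1) = inv\<^bsub>H\<^esub> x \<otimes>\<^bsub>H\<^esub> x [^]\<^bsub>H\<^esub> j"
      using H.pair_powers_upto_iff[OF ixc x] by blast
    moreover have "x [^]\<^bsub>H\<^esub> (m + 1) \<noteq> x [^]\<^bsub>H\<^esub> j" using j(1) H.pow_inj[OF x] n by fastforce
    ultimately have "x \<otimes>\<^bsub>H\<^esub> x [^]\<^bsub>H\<^esub> (m + 1) = x \<otimes>\<^bsub>H\<^esub> (inv\<^bsub>H\<^esub> x \<otimes>\<^bsub>H\<^esub> x [^]\<^bsub>H\<^esub> j)" by simp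
    also have "\<dots> = x [^]\<^bsub>H\<^esub> j" using x by (simp flip: H.m_assoc)
    also have "x \<otimes>\<^bsub>H\<^esub> x [^]\<^bsub>H\<^esub> (m + 1) = x [^]\<^bsub>H\<^esub> (m + 2)" using H.nat_pow_Suc2[OF x, of "m + 1"] by simp
    finally show False using j(1) H.pow_inj[OF x, of "m + 2" j] n by simp
  qed
  ultimately have "z = m + 2" using z(1) n by simp
  then show ?thesis using z(2) K.inv_eq_pow[OF u(1)] u(2) n by simp
qed

text \<open>
  With \<open>n\<close> the order of \<open>x\<close>, the identity is \<open>{\<one>, x\<^sup>i} {\<one>, x}\<^sup>n\<^sup>-\<^sup>2\<^sup>-\<^sup>i = {\<one>, x}\<^sup>n\<^sup>-\<^sup>2\<close>: two intervals of exponents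
  overlap or touch, which is where \<open>2 i < n\<close> enters.  If \<open>g (x\<^sup>i) = (g x)\<^sup>z\<close>, the missing exponent \<open>n - 1\<close>
  forces \<open>z \<le> i\<close>, and the presence of \<open>n - 2\<close> forces \<open>z \<ge> i\<close>.
\<close>
lemma g_small_pow:
  assumes x: "x \<in> carrier H" and i: "0 < i" "2 * i < H.ord x"
  shows "g (x [^]\<^bsub>H\<^esub> i) = g x [^]\<^bsub>K\<^esub> i"
proof -
  let ?n = "H.ord x" and ?u = "g x"
  define k where "k = ?n - 2 - i"
  have n: "?n = k + i + 2" "i \<le> k + 1" using i by (simp_all add: k_def)
  have u: "?u \<in> carrier K" "K.ord ?u = ?n" using g_closed[OF x] ord_g[OF x] by auto
  have xi: "x [^]\<^bsub>H\<^esub> i \<in> carrier H" using x by simp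
  obtain z where z: "z < ?n" "g (x [^]\<^bsub>H\<^esub> i) = ?u [^]\<^bsub>K\<^esub> z"
    using g_pow_exp[OF x H.powers_pow] by metis
  have "{\<one>\<^bsub>H\<^esub>, x [^]\<^bsub>H\<^esub> i} <#>\<^bsub>H\<^esub> powers_upto H x k = powers_upto H x (k + i)"
  proof (rule subset_antisym; rule subsetI)
    fix w assume "w \<in> {\<one>\<^bsub>H\<^esub>, x [^]\<^bsub>H\<^esub> i} <#>\<^bsub>H\<^esub> powers_upto H x k"
    then obtain j where "j \<le> k" "w = x [^]\<^bsub>H\<^esub> j \<or> w = x [^]\<^bsub>H\<^esub> i \<otimes>\<^bsub>H\<^esub> x [^]\<^bsub>H\<^esub> j"
      using H.pair_powers_upto_iff[OF xi x] by auto
    then have "\<exists>l\<le>k+i. w = x [^]\<^bsub>H\<^esub> l" using x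
      by (metis H.nat_pow_mult add.commute add_le_mono1 le_add1 le_trans)
    then show "w \<in> powers_upto H x (k + i)" by (auto simp: powers_upto_def)
  next
    fix w assume "w \<in> powers_upto H x (k + i)"
    then obtain l where l: "l \<le> k + i" "w = x [^]\<^bsub>H\<^esub> l" by (auto simp: powers_upto_def)
    have "l \<le> k \<or> i \<le> l \<and> l - i \<le> k" using n l by linarith
    moreover have "w = x [^]\<^bsub>H\<^esub> i \<otimes>\<^bsub>H\<^esub> x [^]\<^bsub>H\<^esub> (l - i)" if "i \<le> l"
      using that l x by (simp add: H.nat_pow_mult)
    ultimately show "w \<in> {\<one>\<^bsub>H\<^esub>, x [^]\<^bsub>H\<^esub> i} <#>\<^bsub>H\<^esub> powers_upto H x k"
      using H.pair_powers_upto_iff[OF xi x] l by metis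
  qed
  then have eq: "{\<one>\<^bsub>K\<^esub>, g (x [^]\<^bsub>H\<^esub> i)} <#>\<^bsub>K\<^esub> powers_upto K ?u k = powers_upto K ?u (k + i)"
    using f_pair_powers_upto[OF xi x] g_powers_upto[OF x] by metis
  note mem = K.pair_powers_upto_iff[OF g_closed[OF xi] u(1), of _ k, unfolded eq, unfolded z(2)]
  have "z \<le> i"
  proof (rule ccontr)
    assume "\<not> z \<le> i"
    define j where "j = k + i + 1 - z"
    have j: "j \<le> k" "z + j = k + i + 1" using \<open>\<not> z \<le> i\<close> z(1) n(1) by (simp_all add: j_def)
    then have "?u [^]\<^bsub>K\<^esub> (k + i + 1) = ?u [^]\<^bsub>K\<^esub> z \<otimes>\<^bsub>K\<^esub> ?u [^]\<^bsub>K\<^esub> j"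
      using K.nat_pow_mult[OF u(1), of z j] by simp
    then have "?u [^]\<^bsub>K\<^esub> (k + i + 1) \<in> powers_upto K ?u (k + i)"
      using mem j(1) by blast
    then show False using K.powers_upto_strict[OF u(1), of "k + i" "k + i + 1"] u(2) n by simp
  qed
  moreover have "i \<le> z"
  proof -
    obtain j where j: "j \<le> k" "?u [^]\<^bsub>K\<^esub> (k + i) = ?u [^]\<^bsub>K\<^esub> j \<or> ?u [^]\<^bsub>K\<^esub> (k + i) = ?u [^]\<^bsub>K\<^esub> z \<otimes>\<^bsub>K\<^esub> ?u [^]\<^bsub>K\<^esub> j"
      using mem pow_mem_powers_upto[of "k + i" "k + i" K ?u] by auto
    moreover have "?u [^]\<^bsub>K\<^esub> (k + i) \<noteq> ?u [^]\<^bsub>K\<^esub> j"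
      using K.pow_inj[OF u(1), of "k + i" j] j(1) i n u(2) by auto
    ultimately have "?u [^]\<^bsub>K\<^esub> (k + i) = ?u [^]\<^bsub>K\<^esub> (z + j)" using u by (simp add: K.nat_pow_mult)
    then have "k + i = z + j"
      using K.pow_inj[OF u(1), of "k + i" "z + j"] j(1) \<open>z \<le> i\<close> n u(2) by simp
    then show ?thesis using j(1) by simp
  qed
  ultimately show ?thesis using z(2) by simp
qed

text \<open>
  Exponents beyond half the order follow by inversion; the middle exponent of an even order gives the
  only element of order two in a cyclic group.
\<close>
lemma g_pow:
  assumes x: "x \<in> carrier H"
  shows "g (x [^]\<^bsub>H\<^esub> i) = g x [^]\<^bsub>K\<^esub> (i::nat)"
proof -
  let ?n = "H.ord x" and ?u = "g x"
  have u: "?u \<in> carrier K" "K.ord ?u = ?n" using g_closed[OF x] ord_g[OF x] by auto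
  have *: "g (x [^]\<^bsub>H\<^esub> i) = ?u [^]\<^bsub>K\<^esub> i" if i: "i < ?n" for i
  proof -
    consider "i = 0" | "0 < i" "2 * i < ?n" | "?n < 2 * i" | "0 < i" "2 * i = ?n" by linarith
    then show ?thesis
    proof cases
      case 1
      then show ?thesis using g_one by simp
    next
      case 2
      then show ?thesis using g_small_pow[OF x] by blast
    next
      case 3
      let ?j = "?n - i"
      have j: "0 < ?j" "2 * ?j < ?n" "?n - ?j = i" using 3 i by simp_all
      have "x [^]\<^bsub>H\<^esub> i = inv\<^bsub>H\<^esub> (x [^]\<^bsub>H\<^esub> ?j)" using H.inv_pow_ord[OF x, of ?j] j by simp
      then have "g (x [^]\<^bsub>H\<^esub> i) = inv\<^bsub>K\<^esub> (?u [^]\<^bsub>K\<^esub> ?j)"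
        using g_inv[of "x [^]\<^bsub>H\<^esub> ?j"] g_small_pow[OF x j(1,2)] x by simp
      then show ?thesis using K.inv_pow_ord[OF u(1), of ?j] u(2) j by simp
    next
      case 4
      have xi: "x [^]\<^bsub>H\<^esub> i \<in> carrier H" using x by simp
      obtain z where z: "z < ?n" "g (x [^]\<^bsub>H\<^esub> i) = ?u [^]\<^bsub>K\<^esub> z"
        using g_pow_exp[OF x H.powers_pow] by metis
      have "inv\<^bsub>H\<^esub> (x [^]\<^bsub>H\<^esub> i) = x [^]\<^bsub>H\<^esub> i" using H.inv_pow_ord[OF x, of i] 4(2)[symmetric] by simp
      then have inv: "inv\<^bsub>K\<^esub> (?u [^]\<^bsub>K\<^esub> z) = ?u [^]\<^bsub>K\<^esub> z" using g_inv[OF xi] z by simp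
      have "z \<noteq> 0"
      proof
        assume "z = 0"
        then have "g (x [^]\<^bsub>H\<^esub> i) = g \<one>\<^bsub>H\<^esub>" using z g_one by simp
        then have "x [^]\<^bsub>H\<^esub> i = x [^]\<^bsub>H\<^esub> (0::nat)" using g_inj[OF xi] by simp
        then show False using H.pow_inj[OF x, of i 0] 4 i by simp
      qed
      moreover have "?u [^]\<^bsub>K\<^esub> (?n - z) = ?u [^]\<^bsub>K\<^esub> z"
        using inv K.inv_pow_ord[OF u(1), of z] u(2) z(1) by simp
      ultimately have "?n - z = z" using K.pow_inj[OF u(1), of "?n - z" z] u(2) z(1) by simp
      then have "z = i" using 4(2) z(1) by linarith
      then show ?thesis using z(2) by simp
    qed
  qed
  have "i mod ?n < ?n" using ord_pos[OF x] by simp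
  then have "g (x [^]\<^bsub>H\<^esub> i) = ?u [^]\<^bsub>K\<^esub> (i mod ?n)" using *[of "i mod ?n"] H.pow_mod_ord[OF x] by simp
  then show ?thesis using K.pow_mod_ord[OF u(1), of i] u(2) by simp
qed

end

section \<open>Opposite groups\<close>

text \<open>
  Used to exchange left and right: \<open>f\<close> is also an isomorphism between the power monoids of the opposite groups.
\<close>
definition opposite :: "('a, 'm) monoid_scheme \<Rightarrow> ('a, 'm) monoid_scheme" where
  "opposite G = G\<lparr>mult := \<lambda>x y. y \<otimes>\<^bsub>G\<^esub> x\<rparr>"

lemma opposite_simps [simp]:
  "carrier (opposite G) = carrier G"
  "\<one>\<^bsub>opposite G\<^esub> = \<one>\<^bsub>G\<^esub>"
  "x \<otimes>\<^bsub>opposite G\<^esub> y = y \<otimes>\<^bsub>G\<^esub> x"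
  by (simp_all add: opposite_def)

lemma carrier_power_monoid_opposite: "carrier (power_monoid (opposite G)) = carrier (power_monoid G)"
  by (simp add: power_monoid_def)

lemma set_mult_opposite: "X <#>\<^bsub>opposite G\<^esub> Y = Y <#>\<^bsub>G\<^esub> X"
  by (auto simp: set_mult_def)

lemma (in group) group_opposite: "group (opposite G)"
  by (rule groupI) (auto simp: m_assoc intro: r_inv inv_closed)

lemma (in group) nat_pow_opposite:
  assumes "x \<in> carrier G"
  shows "x [^]\<^bsub>opposite G\<^esub> (n::nat) = x [^] n"
proof -
  interpret op: group "opposite G" by (rule group_opposite)
  show ?thesis using assms by (induction n) (auto simp flip: nat_pow_Suc2)
qed

lemma (in group) ord_opposite:
  assumes "x \<in> carrier G"
  shows "group.ord (opposite G) x = ord x"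
proof -
  interpret op: group "opposite G" by (rule group_opposite)
  show ?thesis using assms by (simp add: op.ord_unique nat_pow_opposite pow_eq_id)
qed

lemma (in group) powers_opposite: "x \<in> carrier G \<Longrightarrow> powers (opposite G) x = powers G x"
  by (simp add: powers_def nat_pow_opposite)

section \<open>The pullback is multiplicative\<close>

context torsion_power_iso
begin

lemma torsion_power_iso_opposite: "torsion_power_iso (opposite H) (opposite K) f g"
proof -
  interpret Ho: group "opposite H" by (rule H.group_opposite)
  interpret Ko: group "opposite K" by (rule K.group_opposite)
  show ?thesis
  proof
    show "f \<in> iso (power_monoid (opposite H)) (power_monoid (opposite K))"
      using f_iso unfolding iso_def hom_def power_monoid_simps(2) set_mult_opposite
        carrier_power_monoid_opposite by auto
  qed (simp_all add: H.ord_opposite ord_pos g_closed g_pair)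
qed

text \<open>
  Write \<open>u = g x\<close>, \<open>v = g y\<close> and \<open>w = g (xy)\<close>, and let \<open>N\<close> be the order of \<open>v\<close>.  Since \<open>x\<close> and \<open>xy\<close> generate the
  same left coset of \<open>\<langle>y\<rangle>\<close>, also \<open>w = u v\<^sup>s\<close> for some \<open>s < N\<close>.  The staircase identity bounds \<open>s\<close>:
  its right-hand side in \<open>K\<close> omits \<open>u v\<^sup>N\<^sup>-\<^sup>1\<close> because no \<open>u\<^sup>i\<close> with \<open>0 < i < d\<close> lies in \<open>\<langle>v\<rangle>\<close>, whereas
  its left-hand side contains \<open>w v\<^sup>j\<close> for \<open>j \<le> N - 3\<close>.  This excludes \<open>s \<ge> 2\<close>, and \<open>s = 0\<close> contradicts
  injectivity.
\<close>
lemma g_mult_if_step: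
  fixes d t :: nat
  assumes x: "x \<in> carrier H" and y: "y \<in> carrier H"
    and d: "0 < d" "\<And>i. 0 < i \<Longrightarrow> i < d \<Longrightarrow> x [^]\<^bsub>H\<^esub> i \<notin> powers H y"
    and xy: "x \<notin> powers H y"
    and t: "x [^]\<^bsub>H\<^esub> d = y [^]\<^bsub>H\<^esub> t" "t + 3 \<le> H.ord y"
  shows "g (x \<otimes>\<^bsub>H\<^esub> y) = g x \<otimes>\<^bsub>K\<^esub> g y"
proof -
  let ?u = "g x" and ?v = "g y" and ?w = "g (x \<otimes>\<^bsub>H\<^esub> y)"
  obtain e where e: "d = Suc e" using d(1) not0_implies_Suc by blast
  define k where "k = H.ord y - 3"
  have k: "H.ord y = k + 3" "t \<le> k" using t(2) by (simp_all add: k_def)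
  have xyc: "x \<otimes>\<^bsub>H\<^esub> y \<in> carrier H" using x y by simp
  have uv: "?u \<in> carrier K" "?v \<in> carrier K" "K.ord ?v = k + 3"
    using x y g_closed ord_g k by auto
  have u_notin: "?u \<notin> powers K ?v" using g_mem_powers_iff[OF y x] xy by simp
  have xy_notin: "x \<otimes>\<^bsub>H\<^esub> y \<notin> powers H y"
    using H.powers_coset_cancel[OF y ord_pos[OF y] H.powers_self[OF y] x] xy by blast

  \<comment> \<open>Both sides are \<open>\<langle>y\<rangle> \<union> x\<langle>y\<rangle>\<close>; transporting this equation to \<open>K\<close> puts \<open>w\<close> into \<open>u\<langle>v\<rangle>\<close>.\<close>
  have "{\<one>\<^bsub>H\<^esub>, x \<otimes>\<^bsub>H\<^esub> y} <#>\<^bsub>H\<^esub> powers H y = {\<one>\<^bsub>H\<^esub>, x} <#>\<^bsub>H\<^esub> powers H y"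
  proof -
    have "(\<lambda>z. x \<otimes>\<^bsub>H\<^esub> y \<otimes>\<^bsub>H\<^esub> z) ` powers H y = (\<lambda>z. x \<otimes>\<^bsub>H\<^esub> z) ` powers H y"
    proof (rule subset_antisym; rule image_subsetI)
      fix z assume z: "z \<in> powers H y"
      then have zc: "z \<in> carrier H" using H.powers_subset[OF y] by blast
      have "x \<otimes>\<^bsub>H\<^esub> y \<otimes>\<^bsub>H\<^esub> z = x \<otimes>\<^bsub>H\<^esub> (y \<otimes>\<^bsub>H\<^esub> z)" using x y zc by (simp add: H.m_assoc)
      moreover have "y \<otimes>\<^bsub>H\<^esub> z \<in> powers H y" using H.powers_mult[OF y H.powers_self[OF y] z] .
      ultimately show "x \<otimes>\<^bsub>H\<^esub> y \<otimes>\<^bsub>H\<^esub> z \<in> (\<lambda>z. x \<otimes>\<^bsub>H\<^esub> z) ` powers H y" by blast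
      have "x \<otimes>\<^bsub>H\<^esub> y \<otimes>\<^bsub>H\<^esub> (inv\<^bsub>H\<^esub> y \<otimes>\<^bsub>H\<^esub> z) = x \<otimes>\<^bsub>H\<^esub> z"
        using x y zc by (simp add: H.m_assoc) (simp flip: H.m_assoc)
      moreover have "inv\<^bsub>H\<^esub> y \<otimes>\<^bsub>H\<^esub> z \<in> powers H y"
        using H.powers_mult[OF y H.powers_inv[OF y ord_pos[OF y] H.powers_self[OF y]] z] .
      ultimately show "x \<otimes>\<^bsub>H\<^esub> z \<in> (\<lambda>z. x \<otimes>\<^bsub>H\<^esub> y \<otimes>\<^bsub>H\<^esub> z) ` powers H y"
        by (metis imageI)
    qed
    then show ?thesis by (simp add: set_mult_def UNION_singleton_eq_range)
  qed
  then have coset: "{\<one>\<^bsub>K\<^esub>, ?w} <#>\<^bsub>K\<^esub> powers K ?v = {\<one>\<^bsub>K\<^esub>, ?u} <#>\<^bsub>K\<^esub> powers K ?v"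
    using f_mult[OF H.pair_closed powers_in_power_monoid[OF y]] x xyc f_powers[OF y] g_pair by metis
  have "\<one>\<^bsub>K\<^esub> \<in> powers K ?v" using K.powers_pow[of ?v 0] by simp
  moreover have "?w = ?w \<otimes>\<^bsub>K\<^esub> \<one>\<^bsub>K\<^esub>" using g_closed[OF xyc] by simp
  ultimately have "?w \<in> {\<one>\<^bsub>K\<^esub>, ?w} <#>\<^bsub>K\<^esub> powers K ?v" unfolding set_mult_iff by blast
  then obtain p where p: "p \<in> powers K ?v" "?w = \<one>\<^bsub>K\<^esub> \<otimes>\<^bsub>K\<^esub> p \<or> ?w = ?u \<otimes>\<^bsub>K\<^esub> p"
    unfolding coset set_mult_iff by blast
  moreover have "?w \<notin> powers K ?v" using g_mem_powers_iff[OF y xyc] xy_notin by simp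
  moreover have "p \<in> carrier K" using p(1) K.powers_subset[OF uv(2)] by blast
  ultimately have "?w = ?u \<otimes>\<^bsub>K\<^esub> p" by auto
  moreover obtain s where s: "s < k + 3" "p = ?v [^]\<^bsub>K\<^esub> s"
    using K.powers_expE[OF uv(2) _ p(1)] uv(3) by auto
  ultimately have w: "?w = ?u \<otimes>\<^bsub>K\<^esub> ?v [^]\<^bsub>K\<^esub> s" by simp

  have "f (powers_upto H x e <#>\<^bsub>H\<^esub> ({\<one>\<^bsub>H\<^esub>, x \<otimes>\<^bsub>H\<^esub> y} <#>\<^bsub>H\<^esub> powers_upto H y k))
      = f (powers_upto H x (Suc e) <#>\<^bsub>H\<^esub> powers_upto H y (Suc k))"
    using H.staircase_identity[OF x y t(1)[unfolded e] k(2)] by simp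
  moreover have "{\<one>\<^bsub>H\<^esub>, x \<otimes>\<^bsub>H\<^esub> y} <#>\<^bsub>H\<^esub> powers_upto H y k \<in> carrier (power_monoid H)"
    using H.mult_closed_power_monoid H.pair_closed[OF xyc] H.powers_upto_closed[OF y] by blast
  ultimately have stair: "powers_upto K ?u e <#>\<^bsub>K\<^esub> ({\<one>\<^bsub>K\<^esub>, ?w} <#>\<^bsub>K\<^esub> powers_upto K ?v k)
      = powers_upto K ?u (Suc e) <#>\<^bsub>K\<^esub> powers_upto K ?v (Suc k)"
    using f_mult H.powers_upto_closed[OF x] H.powers_upto_closed[OF y]
      f_pair_powers_upto[OF xyc y] g_powers_upto[OF x] g_powers_upto[OF y] by metis

  have top: "?u \<otimes>\<^bsub>K\<^esub> ?v [^]\<^bsub>K\<^esub> (k + 2) \<notin> powers_upto K ?u (Suc e) <#>\<^bsub>K\<^esub> powers_upto K ?v (Suc k)"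
  proof
    assume "?u \<otimes>\<^bsub>K\<^esub> ?v [^]\<^bsub>K\<^esub> (k + 2) \<in> powers_upto K ?u (Suc e) <#>\<^bsub>K\<^esub> powers_upto K ?v (Suc k)"
    then obtain i l where il: "i \<le> Suc e" "l \<le> Suc k"
      "?u \<otimes>\<^bsub>K\<^esub> ?v [^]\<^bsub>K\<^esub> (k + 2) = ?u [^]\<^bsub>K\<^esub> i \<otimes>\<^bsub>K\<^esub> ?v [^]\<^bsub>K\<^esub> l"
      by (auto simp: set_mult_iff powers_upto_def)
    have ov: "0 < K.ord ?v" using uv(3) by simp
    show False
    proof (cases i)
      case 0
      then have "?u \<otimes>\<^bsub>K\<^esub> ?v [^]\<^bsub>K\<^esub> (k + 2) = ?v [^]\<^bsub>K\<^esub> l" using il(3) uv(2) by simp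
      then have "?u \<otimes>\<^bsub>K\<^esub> ?v [^]\<^bsub>K\<^esub> (k + 2) \<in> powers K ?v" using K.powers_pow by metis
      then have "?u \<in> powers K ?v"
        using K.powers_coset_cancel[OF uv(2) ov K.powers_pow uv(1)] by blast
      then show False using u_notin by blast
    next
      case (Suc j)
      have "?u \<otimes>\<^bsub>K\<^esub> ?v [^]\<^bsub>K\<^esub> (k + 2) = ?u \<otimes>\<^bsub>K\<^esub> ?u [^]\<^bsub>K\<^esub> j \<otimes>\<^bsub>K\<^esub> ?v [^]\<^bsub>K\<^esub> l"
        using il(3) Suc K.nat_pow_Suc2[OF uv(1), of j] by metis
      also have "\<dots> = ?u \<otimes>\<^bsub>K\<^esub> (?u [^]\<^bsub>K\<^esub> j \<otimes>\<^bsub>K\<^esub> ?v [^]\<^bsub>K\<^esub> l)"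
        using uv by (intro K.m_assoc) simp_all
      finally have "?u \<otimes>\<^bsub>K\<^esub> ?v [^]\<^bsub>K\<^esub> (k + 2) = \<dots>" .
      then have eq: "?v [^]\<^bsub>K\<^esub> (k + 2) = ?u [^]\<^bsub>K\<^esub> j \<otimes>\<^bsub>K\<^esub> ?v [^]\<^bsub>K\<^esub> l" using uv by (metis K.l_cancel K.m_closed K.nat_pow_closed)
      then have "?u [^]\<^bsub>K\<^esub> j \<otimes>\<^bsub>K\<^esub> ?v [^]\<^bsub>K\<^esub> l \<in> powers K ?v" using K.powers_pow by metis
      then have "?u [^]\<^bsub>K\<^esub> j \<in> powers K ?v"
        using K.powers_coset_cancel[OF uv(2) ov K.powers_pow K.nat_pow_closed[OF uv(1)]] by blast
      then have "x [^]\<^bsub>H\<^esub> j \<in> powers H y"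
        using g_mem_powers_iff[OF y, of "x [^]\<^bsub>H\<^esub> j"] g_pow[OF x] x by simp
      then have "j = 0" using d(2)[of j] il(1) Suc e by auto
      then have "?v [^]\<^bsub>K\<^esub> (k + 2) = ?v [^]\<^bsub>K\<^esub> l" using eq uv by simp
      then show False using K.pow_inj[OF uv(2), of "k + 2" l] uv(3) il(2) by simp
    qed
  qed
  have "s < 2"
  proof (rule ccontr)
    assume "\<not> s < 2"
    \<comment> \<open>The exponent \<open>j\<close> is chosen to make \<open>w v\<^sup>j\<close> the omitted element \<open>u v\<^sup>N\<^sup>-\<^sup>1\<close>, where \<open>N = k + 3\<close>.\<close>
    define j where "j = k + 2 - s"
    have j: "j \<le> k" "s + j = k + 2" using \<open>\<not> s < 2\<close> s(1) by (simp_all add: j_def)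
    have "?w \<otimes>\<^bsub>K\<^esub> ?v [^]\<^bsub>K\<^esub> j = ?u \<otimes>\<^bsub>K\<^esub> ?v [^]\<^bsub>K\<^esub> (k + 2)"
      using w uv j K.nat_pow_mult[OF uv(2), of s j] by (simp add: K.m_assoc)
    then have "?u \<otimes>\<^bsub>K\<^esub> ?v [^]\<^bsub>K\<^esub> (k + 2) \<in> {\<one>\<^bsub>K\<^esub>, ?w} <#>\<^bsub>K\<^esub> powers_upto K ?v k"
      using pow_mem_powers_upto[OF j(1), of K ?v] unfolding set_mult_iff by force
    moreover have "?u \<otimes>\<^bsub>K\<^esub> ?v [^]\<^bsub>K\<^esub> (k + 2) = \<one>\<^bsub>K\<^esub> \<otimes>\<^bsub>K\<^esub> (?u \<otimes>\<^bsub>K\<^esub> ?v [^]\<^bsub>K\<^esub> (k + 2))" using uv by simp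
    ultimately have "?u \<otimes>\<^bsub>K\<^esub> ?v [^]\<^bsub>K\<^esub> (k + 2) \<in> powers_upto K ?u e <#>\<^bsub>K\<^esub> ({\<one>\<^bsub>K\<^esub>, ?w} <#>\<^bsub>K\<^esub> powers_upto K ?v k)"
      using K.one_in_powers_upto[of ?u e] unfolding set_mult_iff[of _ K "powers_upto K ?u e"] by blast
    then show False using top stair by simp
  qed
  moreover have "s \<noteq> 0"
  proof
    assume "s = 0"
    then have "?w = ?u" using w uv by simp
    then have "x \<otimes>\<^bsub>H\<^esub> y = x" using g_inj[OF xyc x] by simp
    then have "y = \<one>\<^bsub>H\<^esub>" using x y H.l_cancel_one by blast
    then show False using k(1) by simp
  qed
  ultimately have "s = 1" by simp
  then show ?thesis using w uv by simp
qed

text \<open>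
  The product \<open>{\<one>, x} {\<one>, y}\<close> then also equals \<open>{\<one>, xy} {\<one>, x}\<close>, so \<open>g (xy)\<close> occurs among the
  elements of \<open>{\<one>, g x} {\<one>, g y}\<close>, and injectivity leaves only \<open>g x g y\<close>.
\<close>
lemma g_mult_if_xyx_eq_y:
  assumes x: "x \<in> carrier H" and y: "y \<in> carrier H"
    and xyx: "x \<otimes>\<^bsub>H\<^esub> y \<otimes>\<^bsub>H\<^esub> x = y" and ne: "x \<otimes>\<^bsub>H\<^esub> y \<noteq> \<one>\<^bsub>H\<^esub>"
    and nx: "x \<noteq> \<one>\<^bsub>H\<^esub>" and ny: "y \<noteq> \<one>\<^bsub>H\<^esub>"
  shows "g (x \<otimes>\<^bsub>H\<^esub> y) = g x \<otimes>\<^bsub>K\<^esub> g y"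
proof -
  have xyc: "x \<otimes>\<^bsub>H\<^esub> y \<in> carrier H" using x y by simp
  have "{\<one>\<^bsub>H\<^esub>, x} <#>\<^bsub>H\<^esub> {\<one>\<^bsub>H\<^esub>, y} = {\<one>\<^bsub>H\<^esub>, x \<otimes>\<^bsub>H\<^esub> y} <#>\<^bsub>H\<^esub> {\<one>\<^bsub>H\<^esub>, x}"
    using H.pair_mult[OF x y] H.pair_mult[OF xyc x] xyx by auto
  then have "{\<one>\<^bsub>K\<^esub>, g x} <#>\<^bsub>K\<^esub> {\<one>\<^bsub>K\<^esub>, g y} = {\<one>\<^bsub>K\<^esub>, g (x \<otimes>\<^bsub>H\<^esub> y)} <#>\<^bsub>K\<^esub> {\<one>\<^bsub>K\<^esub>, g x}"
    using f_mult H.pair_closed g_pair x y xyc by metis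
  then have "{\<one>\<^bsub>K\<^esub>, g x, g y, g x \<otimes>\<^bsub>K\<^esub> g y} = {\<one>\<^bsub>K\<^esub>, g (x \<otimes>\<^bsub>H\<^esub> y), g x, g (x \<otimes>\<^bsub>H\<^esub> y) \<otimes>\<^bsub>K\<^esub> g x}"
    using K.pair_mult g_closed x y xyc by simp
  then have "g (x \<otimes>\<^bsub>H\<^esub> y) \<in> {\<one>\<^bsub>K\<^esub>, g x, g y, g x \<otimes>\<^bsub>K\<^esub> g y}" by blast
  moreover have "g (x \<otimes>\<^bsub>H\<^esub> y) \<noteq> \<one>\<^bsub>K\<^esub>" using g_inj[OF xyc H.one_closed] g_one ne by auto
  moreover have "g (x \<otimes>\<^bsub>H\<^esub> y) \<noteq> g x" using g_inj[OF xyc x] x y ny by (auto simp: H.l_cancel_one)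
  moreover have "g (x \<otimes>\<^bsub>H\<^esub> y) \<noteq> g y" using g_inj[OF xyc y] x y nx by (auto simp: H.r_cancel_one)
  ultimately show ?thesis by blast
qed

text \<open>
  Let \<open>d\<close> be the first positive exponent with \<open>x\<^sup>d = y\<^sup>t\<close> for some \<open>t\<close> below the order \<open>N\<close> of \<open>y\<close>.  The case \<open>t = N - 1\<close>
  would make \<open>y\<close> a power of \<open>x\<close>.  If \<open>t = N - 2\<close>, then \<open>y\<^sup>2\<close> is the inverse of \<open>x\<^sup>d\<close>, hence a power of \<open>x\<close>, and the mirror image
  of \<open>g_mult_if_step\<close> applies with exponent \<open>2\<close>, the hypothesis on squares excluding the corresponding
  exception there.
\<close>
lemma g_mult_generic:
  assumes x: "x \<in> carrier H" and y: "y \<in> carrier H"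
    and nxy: "x \<notin> powers H y" and nyx: "y \<notin> powers H x"
    and sq: "x \<otimes>\<^bsub>H\<^esub> x \<otimes>\<^bsub>H\<^esub> (y \<otimes>\<^bsub>H\<^esub> y) \<noteq> \<one>\<^bsub>H\<^esub>"
  shows "g (x \<otimes>\<^bsub>H\<^esub> y) = g x \<otimes>\<^bsub>K\<^esub> g y"
proof -
  have sq': "y \<otimes>\<^bsub>H\<^esub> y \<otimes>\<^bsub>H\<^esub> (x \<otimes>\<^bsub>H\<^esub> x) \<noteq> \<one>\<^bsub>H\<^esub>"
    using sq x y H.inv_comm[of "y \<otimes>\<^bsub>H\<^esub> y" "x \<otimes>\<^bsub>H\<^esub> x"] by auto
  let ?P = "\<lambda>i::nat. 0 < i \<and> x [^]\<^bsub>H\<^esub> i \<in> powers H y"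
  define d where "d = (LEAST i. ?P i)"
  have "?P (H.ord x)" using x ord_pos[OF x] H.powers_pow[of y 0] by simp
  then have "?P d" unfolding d_def by (rule LeastI)
  then have d: "0 < d" "x [^]\<^bsub>H\<^esub> d \<in> powers H y" by blast+
  have dmin: "x [^]\<^bsub>H\<^esub> i \<notin> powers H y" if "0 < i" "i < d" for i
    using that not_less_Least[of i ?P] unfolding d_def by blast
  obtain t where t: "t < H.ord y" "x [^]\<^bsub>H\<^esub> d = y [^]\<^bsub>H\<^esub> t"
    using H.powers_expE[OF y ord_pos[OF y] d(2)] .
  have "t + 1 \<noteq> H.ord y"
  proof
    assume *: "t + 1 = H.ord y"
    then have "inv\<^bsub>H\<^esub> y = y [^]\<^bsub>H\<^esub> t" using H.inv_eq_pow[OF y] ord_pos[OF y] by (metis add_diff_cancel_right')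
    then have "inv\<^bsub>H\<^esub> y \<in> powers H x" using t(2) H.powers_pow by metis
    then have "y \<in> powers H x" using H.powers_inv[OF x ord_pos[OF x], of "inv\<^bsub>H\<^esub> y"] y by simp
    then show False using nyx by blast
  qed
  then consider "t + 3 \<le> H.ord y" | "t + 2 = H.ord y" using t(1) by linarith
  then show ?thesis
  proof cases
    case 1
    then show ?thesis using g_mult_if_step[OF x y d(1) dmin nxy t(2)] by blast
  next
    case 2
    have "y [^]\<^bsub>H\<^esub> (2::nat) \<otimes>\<^bsub>H\<^esub> y [^]\<^bsub>H\<^esub> t = \<one>\<^bsub>H\<^esub>"
      using 2 y by (simp add: H.nat_pow_mult add.commute)
    then have "y [^]\<^bsub>H\<^esub> (2::nat) = inv\<^bsub>H\<^esub> (x [^]\<^bsub>H\<^esub> d)"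
      using t(2) y by (intro H.inv_equality[symmetric]) simp_all
    then have y2: "y [^]\<^bsub>H\<^esub> (2::nat) \<in> powers H x"
      using H.powers_inv[OF x ord_pos[OF x] H.powers_pow] by simp
    obtain s where s: "s < H.ord x" "y [^]\<^bsub>H\<^esub> (2::nat) = x [^]\<^bsub>H\<^esub> s"
      using H.powers_expE[OF x ord_pos[OF x] y2] .
    have y2': "y \<otimes>\<^bsub>H\<^esub> y = x [^]\<^bsub>H\<^esub> s" using s y by (simp add: numeral_2_eq_2)
    have "s + 1 \<noteq> H.ord x"
    proof
      assume "s + 1 = H.ord x"
      then have "inv\<^bsub>H\<^esub> x = x [^]\<^bsub>H\<^esub> s" using H.inv_eq_pow[OF x] ord_pos[OF x] by (metis add_diff_cancel_right')
      then have "inv\<^bsub>H\<^esub> x \<in> powers H y" using s(2) H.powers_pow by metis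
      then have "x \<in> powers H y" using H.powers_inv[OF y ord_pos[OF y], of "inv\<^bsub>H\<^esub> x"] x by simp
      then show False using nxy by blast
    qed
    moreover have "s + 2 \<noteq> H.ord x"
    proof
      assume "s + 2 = H.ord x"
      then have "x [^]\<^bsub>H\<^esub> s \<otimes>\<^bsub>H\<^esub> x [^]\<^bsub>H\<^esub> (2::nat) = \<one>\<^bsub>H\<^esub>" using x by (simp add: H.nat_pow_mult)
      then show False using sq' y2' x by (simp add: numeral_2_eq_2)
    qed
    ultimately have s3: "s + 3 \<le> H.ord x" using s(1) by linarith
    interpret op: torsion_power_iso "opposite H" "opposite K" f g by (rule torsion_power_iso_opposite)
    have "g (y \<otimes>\<^bsub>opposite H\<^esub> x) = g y \<otimes>\<^bsub>opposite K\<^esub> g x"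
    proof (rule op.g_mult_if_step)
      show "y [^]\<^bsub>opposite H\<^esub> i \<notin> powers (opposite H) x" if "0 < i" "i < 2" for i :: nat
      proof -
        have "i = 1" using that by simp
        then show ?thesis using nyx x y by (simp add: H.nat_pow_opposite H.powers_opposite)
      qed
    qed (use x y nyx s s3 in \<open>simp_all add: H.nat_pow_opposite H.powers_opposite H.ord_opposite\<close>)
    then show ?thesis by simp
  qed
qed

text \<open>
  In the remaining case \<open>x\<^sup>2 y\<^sup>2 = \<one>\<close> it is enough to know \<open>g\<close> on the product of \<open>xy\<close> and \<open>y\<^sup>-\<^sup>1\<close>.  This pair is generic,
  unless \<open>(xy)\<^sup>2 = y\<^sup>2\<close>, which means \<open>xyx = y\<close>.
\<close>
lemma g_mult:
  assumes x: "x \<in> carrier H" and y: "y \<in> carrier H"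
  shows "g (x \<otimes>\<^bsub>H\<^esub> y) = g x \<otimes>\<^bsub>K\<^esub> g y"
proof -
  consider "x \<in> powers H y" | "y \<in> powers H x"
    | "x \<notin> powers H y" "y \<notin> powers H x" "x \<otimes>\<^bsub>H\<^esub> x \<otimes>\<^bsub>H\<^esub> (y \<otimes>\<^bsub>H\<^esub> y) \<noteq> \<one>\<^bsub>H\<^esub>"
    | "x \<notin> powers H y" "y \<notin> powers H x" "x \<otimes>\<^bsub>H\<^esub> x \<otimes>\<^bsub>H\<^esub> (y \<otimes>\<^bsub>H\<^esub> y) = \<one>\<^bsub>H\<^esub>" by blast
  then show ?thesis
  proof cases
    case 1
    then obtain i :: nat where "x = y [^]\<^bsub>H\<^esub> i" by (auto simp: powers_def)
    then show ?thesis using g_pow[OF y, of "Suc i"] g_pow[OF y, of i] by simp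
  next
    case 2
    then obtain i :: nat where "y = x [^]\<^bsub>H\<^esub> i" by (auto simp: powers_def)
    then show ?thesis
      using g_pow[OF x, of "Suc i"] g_pow[OF x, of i] H.nat_pow_Suc2[OF x, of i]
        K.nat_pow_Suc2[OF g_closed[OF x], of i] by simp
  next
    case 3
    then show ?thesis using g_mult_generic[OF x y] by blast
  next
    case 4
    let ?z = "x \<otimes>\<^bsub>H\<^esub> y"
    have zc: "?z \<in> carrier H" and yc: "inv\<^bsub>H\<^esub> y \<in> carrier H" using x y by simp_all
    have nx: "x \<noteq> \<one>\<^bsub>H\<^esub>" "y \<noteq> \<one>\<^bsub>H\<^esub>"
      using 4(1,2) H.powers_pow[of y 0] H.powers_pow[of x 0] by auto
    have iy: "inv\<^bsub>H\<^esub> y \<in> powers H y" using H.powers_inv[OF y ord_pos[OF y] H.powers_self[OF y]] .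
    have nz: "?z \<notin> powers H y"
      using H.powers_coset_cancel[OF y ord_pos[OF y] H.powers_self[OF y] x] 4(1) by blast
    have zy: "?z \<otimes>\<^bsub>H\<^esub> inv\<^bsub>H\<^esub> y = x" using x y by (simp add: H.m_assoc)
    show ?thesis
    proof (cases "?z \<otimes>\<^bsub>H\<^esub> ?z = y \<otimes>\<^bsub>H\<^esub> y")
      case True
      then have "?z \<otimes>\<^bsub>H\<^esub> x \<otimes>\<^bsub>H\<^esub> y = y \<otimes>\<^bsub>H\<^esub> y" using x y by (simp add: H.m_assoc)
      then have "?z \<otimes>\<^bsub>H\<^esub> x = y" using x y by simp
      moreover have "?z \<noteq> \<one>\<^bsub>H\<^esub>" using nz H.powers_pow[of y 0] by auto
      ultimately show ?thesis using g_mult_if_xyx_eq_y[OF x y] nx by blast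
    next
      case False
      have "inv\<^bsub>H\<^esub> y \<notin> powers H ?z"
      proof
        \<comment> \<open>Then \<open>x\<close> and \<open>y\<close> commute, so \<open>(xy)\<^sup>2 = x\<^sup>2 y\<^sup>2 = \<one>\<close>, and \<open>y\<close> would be one of \<open>\<one>\<close> and \<open>xy\<close>.\<close>
        assume "inv\<^bsub>H\<^esub> y \<in> powers H ?z"
        then have yz: "y \<in> powers H ?z" using H.powers_inv[OF zc ord_pos[OF zc], of "inv\<^bsub>H\<^esub> y"] y by simp
        then obtain j :: nat where j: "y = ?z [^]\<^bsub>H\<^esub> j" by (auto simp: powers_def)
        have "?z \<otimes>\<^bsub>H\<^esub> y = y \<otimes>\<^bsub>H\<^esub> ?z"
          using H.nat_pow_comm[OF zc, of 1 j] zc by (simp flip: j)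
        then have "x \<otimes>\<^bsub>H\<^esub> y \<otimes>\<^bsub>H\<^esub> y = y \<otimes>\<^bsub>H\<^esub> x \<otimes>\<^bsub>H\<^esub> y" using x y by (simp add: H.m_assoc)
        then have comm: "x \<otimes>\<^bsub>H\<^esub> y = y \<otimes>\<^bsub>H\<^esub> x" using x y by simp
        have "?z \<otimes>\<^bsub>H\<^esub> ?z = x \<otimes>\<^bsub>H\<^esub> (y \<otimes>\<^bsub>H\<^esub> x) \<otimes>\<^bsub>H\<^esub> y" using x y by (simp add: H.m_assoc)
        also have "\<dots> = x \<otimes>\<^bsub>H\<^esub> x \<otimes>\<^bsub>H\<^esub> (y \<otimes>\<^bsub>H\<^esub> y)" using x y by (simp flip: comm add: H.m_assoc)
        finally have zz: "?z [^]\<^bsub>H\<^esub> (2::nat) = \<one>\<^bsub>H\<^esub>" using 4(3) zc by (simp add: numeral_2_eq_2)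
        have "H.ord ?z dvd 2" using zz zc H.pow_eq_id by blast
        then have "H.ord ?z \<le> 2" by (rule dvd_imp_le) simp
        then obtain i where i: "i < 2" "y = ?z [^]\<^bsub>H\<^esub> (i::nat)"
          using H.powers_expE[OF zc ord_pos[OF zc] yz] by (metis less_le_trans)
        then have "i = 0 \<or> i = 1" by auto
        then have "y = \<one>\<^bsub>H\<^esub> \<or> y = ?z" using i zc by auto
        then show False using nx x y nz H.powers_self[OF y] by auto
      qed
      moreover have "?z \<notin> powers H (inv\<^bsub>H\<^esub> y)"
      proof
        assume "?z \<in> powers H (inv\<^bsub>H\<^esub> y)"
        then obtain i :: nat where "?z = (inv\<^bsub>H\<^esub> y) [^]\<^bsub>H\<^esub> i" by (auto simp: powers_def)
        then have "?z = inv\<^bsub>H\<^esub> (y [^]\<^bsub>H\<^esub> i)" using y by (simp add: H.nat_pow_inv)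
        then show False using nz H.powers_inv[OF y ord_pos[OF y] H.powers_pow] by metis
      qed
      moreover have "?z \<otimes>\<^bsub>H\<^esub> ?z \<otimes>\<^bsub>H\<^esub> (inv\<^bsub>H\<^esub> y \<otimes>\<^bsub>H\<^esub> inv\<^bsub>H\<^esub> y) \<noteq> \<one>\<^bsub>H\<^esub>"
      proof
        assume *: "?z \<otimes>\<^bsub>H\<^esub> ?z \<otimes>\<^bsub>H\<^esub> (inv\<^bsub>H\<^esub> y \<otimes>\<^bsub>H\<^esub> inv\<^bsub>H\<^esub> y) = \<one>\<^bsub>H\<^esub>"
        have "inv\<^bsub>H\<^esub> (inv\<^bsub>H\<^esub> y \<otimes>\<^bsub>H\<^esub> inv\<^bsub>H\<^esub> y) = ?z \<otimes>\<^bsub>H\<^esub> ?z"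
          using * x y by (intro H.inv_equality) simp_all
        then show False using False y by (simp add: H.inv_mult_group)
      qed
      ultimately have "g (?z \<otimes>\<^bsub>H\<^esub> inv\<^bsub>H\<^esub> y) = g ?z \<otimes>\<^bsub>K\<^esub> g (inv\<^bsub>H\<^esub> y)"
        using g_mult_generic[OF zc yc] by blast
      then have "g x = g ?z \<otimes>\<^bsub>K\<^esub> inv\<^bsub>K\<^esub> (g y)" using zy g_inv[OF y] by simp
      then show ?thesis using g_closed x y zc by (simp add: K.m_assoc)
    qed
  qed
qed

end

text \<open>
  Surjectivity of \<open>g\<close> comes from applying \<open>image_of_pair\<close> to the inverse of \<open>f\<close>.
\<close>
lemma (in power_iso) pullback_iso:
  assumes H: "group H" "\<And>x. x \<in> carrier H \<Longrightarrow> group.ord H x > 0"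
    and K: "group K" "\<And>y. y \<in> carrier K \<Longrightarrow> group.ord K y > 0"
  shows "pullback H K f \<in> iso H K"
proof -
  let ?h = "inv_into (carrier (power_monoid H)) f"
  interpret inv: power_iso K H ?h by (rule inverse_power_iso)
  define g where "g = (\<lambda>x\<in>carrier H. SOME y. y \<in> carrier K \<and> f {\<one>\<^bsub>H\<^esub>, x} = {\<one>\<^bsub>K\<^esub>, y})"
  have g: "g x \<in> carrier K \<and> f {\<one>\<^bsub>H\<^esub>, x} = {\<one>\<^bsub>K\<^esub>, g x}" if "x \<in> carrier H" for x
  proof -
    have "\<exists>y. y \<in> carrier K \<and> f {\<one>\<^bsub>H\<^esub>, x} = {\<one>\<^bsub>K\<^esub>, y}"
      using image_of_pair[OF H(1) that H(2)[OF that]] by blast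
    from someI_ex[OF this] show ?thesis using that by (simp add: g_def)
  qed
  interpret H: group H by (rule H(1))
  interpret K: group K by (rule K(1))
  interpret torsion_power_iso H K f g
    by unfold_locales (use g H(2) in auto)
  have surj: "y \<in> g ` carrier H" if y: "y \<in> carrier K" for y
  proof -
    obtain x where x: "x \<in> carrier H" "?h {\<one>\<^bsub>K\<^esub>, y} = {\<one>\<^bsub>H\<^esub>, x}"
      using inv.image_of_pair[OF K(1) y K(2)[OF y]] by blast
    have "bij_betw f (carrier (power_monoid H)) (carrier (power_monoid K))"
      using f_iso by (simp add: iso_def)
    then have "f (?h {\<one>\<^bsub>K\<^esub>, y}) = {\<one>\<^bsub>K\<^esub>, y}"
      using K.pair_closed[OF y] by (simp add: bij_betw_def f_inv_into_f)
    then have "{\<one>\<^bsub>K\<^esub>, y} = {\<one>\<^bsub>K\<^esub>, g x}" using x g by simp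
    then have "y = g x" by (auto simp: doubleton_eq_iff)
    then show ?thesis using x by blast
  qed
  have bij: "bij_betw g (carrier H) (carrier K)"
    unfolding bij_betw_def using surj g_closed g_inj by (auto intro: inj_onI)
  then have "is_pullback H K f g"
    using g by (auto simp: is_pullback_def g_def)
  then have "pullback H K f = g" by (rule pullback_eq)
  moreover have "g \<in> iso H K"
    by (rule isoI) (use bij g_closed g_mult in \<open>auto intro!: homI\<close>)
  ultimately show ?thesis by simp
qed

theorem theorem5p1:
  fixes H :: "('a, 'm) monoid_scheme" and K :: "('b, 'n) monoid_scheme"
    and f :: "'a set \<Rightarrow> 'b set"
  assumes "monoid_cancel H" and "monoid_cancel K"
    and "torsion_monoid H \<or> torsion_monoid K"
    and "f \<in> iso (power_monoid H) (power_monoid K)"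
  shows "group H \<and> group K \<and> pullback H K f \<in> iso H K"
proof -
  interpret H: monoid_cancel H by fact
  interpret K: monoid_cancel K by fact
  interpret power_iso H K f by unfold_locales (rule assms(4))
  interpret inv: power_iso K H "inv_into (carrier (power_monoid H)) f" by (rule inverse_power_iso)
  from assms(3) show ?thesis
  proof
    assume "torsion_monoid H"
    from torsion_transfer[OF assms(1,2) this] show ?thesis using pullback_iso by blast
  next
    assume "torsion_monoid K"
    from inv.torsion_transfer[OF assms(2,1) this] show ?thesis using pullback_iso by blast
  qed
qed

end
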